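(* Let $(R,\mathfrak{m})$ be a commutative local Noetherian ring, $M$ a nonzero finitely generated $R$-module of dimension one and depth zero, and $n$ an integer such that $\mathfrak{m}^nM\cap\Gamma_{\mathfrak{m}}(M)=(0)$. Then for any parameter $a$ of $M$, and any parameter $b$ of $M$ with $b\in(a^{n+1})$, the $R$-module $\operatorname{Hom}_R(R/(a),M/bM)$ is decomposable.
   Context: $\Gamma_{\mathfrak{m}}(M)=\{x\in M : \mathfrak{m}^k x=0 \text{ for some } k\ge 1\}$ is the $\mathfrak{m}$-torsion submodule of $M$. A system of parameters of a finitely generated $R$-module $M$ of dimension $d$ is a set of $d$ elements of $\mathfrak{m}$ generating an ideal $\mathfrak{a}$ such that $M/\mathfrak{a}M$ has finite length. When $d=1$, a parameter of $M$ is an element $a\in\mathfrak{m}$ such that $M/aM$ has finite length. A module is decomposable if it is the direct sum of two nonzero submodules. *)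

theory Defs
  imports "HOL-Library.Extended_Nat" "HOL-Algebra.Module" "HOL-Algebra.Ideal_Product"
    "HOL-Algebra.Ring_Divisibility"
begin

locale local_ring = cring R for R (structure) and \<mm> +
  assumes maximal: "maximalideal \<mm> R"
    and unique: "maximalideal J R \<Longrightarrow> J = \<mm>"

text \<open>\<^const>\<open>ideals_set\<close> is the multiplicative monoid of ideals with unit \<^term>\<open>carrier R\<close>,
  so the zeroth power of an ideal is the whole ring.\<close>

definition ideal_pow :: "('a, 'r) ring_scheme \<Rightarrow> 'a set \<Rightarrow> nat \<Rightarrow> 'a set" where
  "ideal_pow R I k = I [^]\<^bsub>ideals_set R\<^esub> k"


definition submodule_span ::
    "('a, 'r) ring_scheme \<Rightarrow> ('a, 'b, 'm) module_scheme \<Rightarrow> 'b set \<Rightarrow> 'b set" where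
  "submodule_span R M S = \<Inter>{N. submodule N R M \<and> S \<subseteq> N}"

definition finitely_generated ::
    "('a, 'r) ring_scheme \<Rightarrow> ('a, 'b, 'm) module_scheme \<Rightarrow> bool" where
  "finitely_generated R M \<longleftrightarrow>
     (\<exists>S. finite S \<and> S \<subseteq> carrier M \<and> submodule_span R M S = carrier M)"

definition ideal_smult ::
    "('a, 'r) ring_scheme \<Rightarrow> 'a set \<Rightarrow> ('a, 'b, 'm) module_scheme \<Rightarrow> 'b set" where
  "ideal_smult R I M = submodule_span R M {r \<odot>\<^bsub>M\<^esub> x | r x. r \<in> I \<and> x \<in> carrier M}"

definition elt_smult :: "'a \<Rightarrow> ('a, 'b, 'm) module_scheme \<Rightarrow> 'b set" where
  "elt_smult a M = {a \<odot>\<^bsub>M\<^esub> x | x. x \<in> carrier M}"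

definition annihilator ::
    "('a, 'r) ring_scheme \<Rightarrow> ('a, 'b, 'm) module_scheme \<Rightarrow> 'a set" where
  "annihilator R M = {r \<in> carrier R. \<forall>x\<in>carrier M. r \<odot>\<^bsub>M\<^esub> x = \<zero>\<^bsub>M\<^esub>}"

definition torsion_submodule ::
    "('a, 'r) ring_scheme \<Rightarrow> 'a set \<Rightarrow> ('a, 'b, 'm) module_scheme \<Rightarrow> 'b set" where
  "torsion_submodule R \<mm> M =
     {x \<in> carrier M. \<exists>k\<ge>1. \<forall>r\<in>ideal_pow R \<mm> k. r \<odot>\<^bsub>M\<^esub> x = \<zero>\<^bsub>M\<^esub>}"


text \<open>The record type \<^type>\<open>module\<close> extends that of rings, but the locale \<^locale>\<open>module\<close>
  ignores the fields \<^const>\<open>monoid.mult\<close> and \<^const>\<open>monoid.one\<close> of the module; the constructions below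
  leave them unspecified.\<close>

definition ring_as_module :: "('a, 'r) ring_scheme \<Rightarrow> ('a, 'a) module" where
  "ring_as_module R =
     \<lparr>carrier = carrier R, monoid.mult = undefined, monoid.one = undefined,
      ring.zero = \<zero>\<^bsub>R\<^esub>, ring.add = ring.add R, module.smult = monoid.mult R\<rparr>"

definition quotient_module ::
    "('a, 'b, 'm) module_scheme \<Rightarrow> 'b set \<Rightarrow> ('a, 'b set) module" where
  "quotient_module M N =
     \<lparr>carrier = a_rcosets\<^bsub>M\<^esub> N, monoid.mult = undefined, monoid.one = undefined,
      ring.zero = N, ring.add = set_add M,
      module.smult = (\<lambda>r C. \<Union>x\<in>C. N +>\<^bsub>M\<^esub> (r \<odot>\<^bsub>M\<^esub> x))\<rparr>"

text \<open>Homomorphisms are taken to be extensional, so that two of them are equal as soon as they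
  agree on \<^term>\<open>carrier M\<close>.\<close>

definition hom_module ::
    "('a, 'r) ring_scheme \<Rightarrow> ('a, 'b, 'm) module_scheme \<Rightarrow> ('a, 'c, 'n) module_scheme
      \<Rightarrow> ('a, 'b \<Rightarrow> 'c) module" where
  "hom_module R M N =
     \<lparr>carrier = {f \<in> carrier M \<rightarrow>\<^sub>E carrier N.
        (\<forall>x\<in>carrier M. \<forall>y\<in>carrier M. f (x \<oplus>\<^bsub>M\<^esub> y) = f x \<oplus>\<^bsub>N\<^esub> f y) \<and>
        (\<forall>r\<in>carrier R. \<forall>x\<in>carrier M. f (r \<odot>\<^bsub>M\<^esub> x) = r \<odot>\<^bsub>N\<^esub> f x)},
      monoid.mult = undefined, monoid.one = undefined,
      ring.zero = (\<lambda>x\<in>carrier M. \<zero>\<^bsub>N\<^esub>),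
      ring.add = (\<lambda>f g. \<lambda>x\<in>carrier M. f x \<oplus>\<^bsub>N\<^esub> g x),
      module.smult = (\<lambda>r f. \<lambda>x\<in>carrier M. r \<odot>\<^bsub>N\<^esub> f x)\<rparr>"

definition decomposable ::
    "('a, 'r) ring_scheme \<Rightarrow> ('a, 'b, 'm) module_scheme \<Rightarrow> bool" where
  "decomposable R M \<longleftrightarrow>
     (\<exists>N L. submodule N R M \<and> submodule L R M \<and> N \<noteq> {\<zero>\<^bsub>M\<^esub>} \<and> L \<noteq> {\<zero>\<^bsub>M\<^esub>} \<and>
        N \<inter> L = {\<zero>\<^bsub>M\<^esub>} \<and> N <+>\<^bsub>M\<^esub> L = carrier M)"


text \<open>The supremum of the lengths \<open>k\<close> of chains \<open>C\<^sub>0 \<subset> \<dots> \<subset> C\<^sub>k\<close> of members of \<open>\<C>\<close>.\<close>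

definition chain_height :: "'a set set \<Rightarrow> enat" where
  "chain_height \<C> =
     (SUP Cs \<in> {Cs. Cs \<noteq> [] \<and> sorted_wrt (\<subset>) Cs \<and> set Cs \<subseteq> \<C>}. enat (length Cs - 1))"

definition krull_dim :: "('a, 'r) ring_scheme \<Rightarrow> enat" where
  "krull_dim R = chain_height {P. primeideal P R}"

text \<open>Only meaningful for nonzero \<open>M\<close>: the zero module also gets dimension 0.\<close>

definition module_dim ::
    "('a, 'r) ring_scheme \<Rightarrow> ('a, 'b, 'm) module_scheme \<Rightarrow> enat" where
  "module_dim R M = krull_dim (R Quot annihilator R M)"

definition module_length ::
    "('a, 'r) ring_scheme \<Rightarrow> ('a, 'b, 'm) module_scheme \<Rightarrow> enat" where
  "module_length R M = chain_height {N. submodule N R M}"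

definition finite_length ::
    "('a, 'r) ring_scheme \<Rightarrow> ('a, 'b, 'm) module_scheme \<Rightarrow> bool" where
  "finite_length R M \<longleftrightarrow> module_length R M < \<infinity>"

definition nonzerodivisor_on :: "'a \<Rightarrow> ('a, 'b, 'm) module_scheme \<Rightarrow> bool" where
  "nonzerodivisor_on a M \<longleftrightarrow> (\<forall>x\<in>carrier M. a \<odot>\<^bsub>M\<^esub> x = \<zero>\<^bsub>M\<^esub> \<longrightarrow> x = \<zero>\<^bsub>M\<^esub>)"

definition regular_sequence ::
    "('a, 'r) ring_scheme \<Rightarrow> ('a, 'b, 'm) module_scheme \<Rightarrow> 'a list \<Rightarrow> bool" where
  "regular_sequence R M xs \<longleftrightarrow>
     set xs \<subseteq> carrier R \<and>
     (\<forall>i<length xs. nonzerodivisor_on (xs ! i)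
        (quotient_module M (ideal_smult R (Idl\<^bsub>R\<^esub> (set (take i xs))) M))) \<and>
     ideal_smult R (Idl\<^bsub>R\<^esub> (set xs)) M \<noteq> carrier M"

definition module_depth ::
    "('a, 'r) ring_scheme \<Rightarrow> 'a set \<Rightarrow> ('a, 'b, 'm) module_scheme \<Rightarrow> enat" where
  "module_depth R \<mm> M =
     (SUP xs \<in> {xs. set xs \<subseteq> \<mm> \<and> regular_sequence R M xs}. enat (length xs))"

text \<open>This is the notion of parameter for modules of dimension one.\<close>

definition parameter ::
    "('a, 'r) ring_scheme \<Rightarrow> 'a set \<Rightarrow> ('a, 'b, 'm) module_scheme \<Rightarrow> 'a \<Rightarrow> bool" where
  "parameter R \<mm> M a \<longleftrightarrow> a \<in> \<mm> \<and> finite_length R (quotient_module M (elt_smult a M))"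


lemma ring_as_module_module: "cring R \<Longrightarrow> module R (ring_as_module R)"
proof -
  assume "cring R" then interpret cring R .
  show ?thesis unfolding ring_as_module_def
    apply (rule moduleI)
    apply (rule is_cring)
    apply (rule abelian_groupI)
    apply (auto simp: a_assoc m_assoc l_distr r_distr intro: a_comm)
    done
qed

lemma submodule_coset:
  assumes "module R M" "submodule N R M"
  shows "abelian_subgroup N M"
  using assms by (metis abelian_subgroupI3 additive_subgroupI module.axioms(2) submodule.axioms(1))

lemma quotient_smult:
  assumes "module R M" "submodule N R M" "r \<in> carrier R" "x \<in> carrier M"
  shows "r \<odot>\<^bsub>quotient_module M N\<^esub> (N +>\<^bsub>M\<^esub> x) = N +>\<^bsub>M\<^esub> (r \<odot>\<^bsub>M\<^esub> x)"
proof -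
  interpret module R M by fact
  interpret N: submodule N R M by fact
  interpret A: abelian_subgroup N M using submodule_coset assms by blast
  have "N +>\<^bsub>M\<^esub> (r \<odot>\<^bsub>M\<^esub> y) = N +>\<^bsub>M\<^esub> (r \<odot>\<^bsub>M\<^esub> x)" if y: "y \<in> N +>\<^bsub>M\<^esub> x" for y
  proof -
    from y obtain h where h: "h \<in> N" "y = h \<oplus>\<^bsub>M\<^esub> x" by (auto simp: a_r_coset_def')
    have "r \<odot>\<^bsub>M\<^esub> y = r \<odot>\<^bsub>M\<^esub> h \<oplus>\<^bsub>M\<^esub> r \<odot>\<^bsub>M\<^esub> x"
      unfolding h(2) by (rule smult_r_distr[OF assms(3) A.a_Hcarr[OF h(1)] assms(4)])
    moreover have "r \<odot>\<^bsub>M\<^esub> h \<in> N" by (rule N.smult_closed[OF assms(3) h(1)])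
    ultimately have "r \<odot>\<^bsub>M\<^esub> y \<in> N +>\<^bsub>M\<^esub> (r \<odot>\<^bsub>M\<^esub> x)" by (auto simp: a_r_coset_def')
    then show ?thesis
      using M.a_repr_independence[OF _ smult_closed[OF assms(3,4)] A.a_subgroup] by simp
  qed
  then have "(\<Union>y\<in>N +>\<^bsub>M\<^esub> x. N +>\<^bsub>M\<^esub> (r \<odot>\<^bsub>M\<^esub> y)) = (\<Union>y\<in>N +>\<^bsub>M\<^esub> x. N +>\<^bsub>M\<^esub> (r \<odot>\<^bsub>M\<^esub> x))"
    by (intro SUP_cong refl)
  also have "\<dots> = N +>\<^bsub>M\<^esub> (r \<odot>\<^bsub>M\<^esub> x)"
    using A.a_rcos_self[OF assms(4)] by (simp add: UN_constant) blast
  finally show ?thesis by (simp add: quotient_module_def)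
qed

lemma quotient_module_module:
  assumes "module R M" "submodule N R M"
  shows "module R (quotient_module M N)"
proof -
  interpret module R M by fact
  interpret N: submodule N R M by fact
  interpret A: abelian_subgroup N M using submodule_coset assms by blast
  have car: "carrier (quotient_module M N) = (\<lambda>x. N +>\<^bsub>M\<^esub> x) ` carrier M"
    by (auto simp: quotient_module_def A_RCOSETS_def')
  have z: "\<zero>\<^bsub>quotient_module M N\<^esub> = N +>\<^bsub>M\<^esub> \<zero>\<^bsub>M\<^esub>"
    by (simp add: quotient_module_def A.a_subset)
  have add: "(N +>\<^bsub>M\<^esub> x) \<oplus>\<^bsub>quotient_module M N\<^esub> (N +>\<^bsub>M\<^esub> y) = N +>\<^bsub>M\<^esub> (x \<oplus>\<^bsub>M\<^esub> y)"
    if "x \<in> carrier M" "y \<in> carrier M" for x y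
    using A.a_rcos_sum that by (simp add: quotient_module_def)
  note sm = quotient_smult[OF assms]
  show ?thesis
    apply (rule moduleI)
          apply (rule is_cring)
         apply (rule abelian_groupI)
    subgoal by (auto simp: car add)
    subgoal by (auto simp: car z)
    subgoal by (auto simp: car add M.a_assoc)
    subgoal by (auto simp: car add M.a_comm)
    subgoal by (auto simp: car add z)
    subgoal for X
      apply (clarsimp simp: car z)
      subgoal for x by (rule bexI[of _ "\<ominus>\<^bsub>M\<^esub> x"]) (auto simp: add M.l_neg)
      done
    by (auto simp: car add sm smult_l_distr smult_r_distr smult_assoc1)
qed

lemma hom_module_module:
  assumes "module R M" "module R N"
  shows "module R (hom_module R M N)"
proof -
  interpret M: module R M by fact
  interpret N: module R N by fact
  have Pi: "f x \<in> carrier N" if "f \<in> carrier M \<rightarrow>\<^sub>E carrier N" "x \<in> carrier M" for f x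
    using that by (auto simp: PiE_def)
  show ?thesis unfolding hom_module_def
    apply (rule moduleI)
          apply (rule M.is_cring)
         apply (rule abelian_groupI)
    subgoal by (auto simp: Pi N.smult_r_distr N.M.a_ac)
    subgoal by (auto)
    subgoal by (auto simp: Pi N.M.a_ac intro!: restrict_ext)
    subgoal by (auto simp: Pi N.M.a_ac intro!: restrict_ext)
    subgoal by (auto simp: Pi PiE_iff intro!: extensionalityI[where A="carrier M"])
    subgoal for f
      apply (rule bexI[of _ "\<lambda>x\<in>carrier M. \<ominus>\<^bsub>N\<^esub> f x"])
       apply (auto simp: Pi N.M.l_neg N.M.minus_add N.smult_r_minus intro!: restrict_ext)
      done
    subgoal by (auto simp: Pi N.smult_r_distr N.smult_assoc1[symmetric] M.R.m_comm)
    subgoal by (auto simp: Pi N.smult_l_distr intro!: restrict_ext)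
    subgoal by (auto simp: Pi N.smult_r_distr intro!: restrict_ext)
    subgoal by (auto simp: Pi N.smult_assoc1 intro!: restrict_ext)
    subgoal by (auto simp: Pi PiE_iff intro!: extensionalityI[where A="carrier M"])
    done
qed

lemma elt_smult_submodule:
  assumes "module R M" "a \<in> carrier R" shows "submodule (elt_smult a M) R M"
proof -
  interpret module R M by fact
  show ?thesis
    apply (rule submoduleI)
        apply (auto simp: elt_smult_def assms(2))
    subgoal by (rule exI[of _ "\<zero>\<^bsub>M\<^esub>"]) (simp add: assms(2))
    subgoal for x by (rule exI[of _ "\<ominus>\<^bsub>M\<^esub> x"]) (simp add: assms(2) smult_r_minus)
    subgoal for x y by (rule exI[of _ "x \<oplus>\<^bsub>M\<^esub> y"]) (simp add: assms(2) smult_r_distr)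
    subgoal for r x
      by (rule exI[of _ "r \<odot>\<^bsub>M\<^esub> x"]) (simp add: assms(2) R.m_comm flip: smult_assoc1)
    done
qed

lemma submodule_span_submodule:
  assumes "module R M" "S \<subseteq> carrier M" shows "submodule (submodule_span R M S) R M"
proof -
  interpret module R M by fact
  show ?thesis
  proof (rule submoduleI)
    show "submodule_span R M S \<subseteq> carrier M"
      using carrier_is_submodule assms(2) unfolding submodule_span_def by blast
    show "\<zero>\<^bsub>M\<^esub> \<in> submodule_span R M S"
      unfolding submodule_span_def using subgroup.one_closed[OF submodule.axioms(1)] by fastforce
  next
    fix x assume "x \<in> submodule_span R M S"
    then show "\<ominus>\<^bsub>M\<^esub> x \<in> submodule_span R M S"
      unfolding submodule_span_def using submoduleE(3) by blast
  next
    fix x y assume "x \<in> submodule_span R M S" "y \<in> submodule_span R M S"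
    then show "x \<oplus>\<^bsub>M\<^esub> y \<in> submodule_span R M S"
      unfolding submodule_span_def using submoduleE(5) by blast
  next
    fix r x assume "r \<in> carrier R" "x \<in> submodule_span R M S"
    then show "r \<odot>\<^bsub>M\<^esub> x \<in> submodule_span R M S"
      unfolding submodule_span_def using submoduleE(4) by blast
  qed
qed

lemma ideal_smult_submodule:
  assumes "module R M" "I \<subseteq> carrier R" shows "submodule (ideal_smult R I M) R M"
proof -
  interpret module R M by fact
  show ?thesis unfolding ideal_smult_def
    using assms by (intro submodule_span_submodule) auto
qed

end

theory Submission
  imports Defs
begin

text \<open>
  A homomorphism \<open>f\<close> from \<open>R/(a)\<close> is determined by \<open>f(1)\<close>, which can be any element killed
  by \<open>a\<close>. So the module in question is \<open>(bM : a)/bM\<close>, where \<open>(bM : a)\<close> consists of the \<open>x\<close>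
  with \<open>a x \<in> bM\<close>. Write \<open>b = d a\<close> with \<open>d = c a\<^sup>n\<close>. If \<open>a x = b y\<close>, then
  \<open>x - d y\<close> is killed by \<open>a\<close>; hence \<open>(bM : a) = dM + (0 : a)\<close>, and \<open>bM \<subseteq> dM\<close>. The two
  summands become the two factors of the decomposition, provided that they meet only in zero and
  that neither is contained in \<open>bM\<close>.

  They meet in zero because \<open>dM\<close> lies in \<open>\<mm>\<^sup>n M\<close> and \<open>(0 : a)\<close> lies in the
  \<open>\<mm>\<close>-torsion of \<open>M\<close> (\<open>parameter_torsion\<close>). The latter rests on two facts.
  The ascending chain of the submodules \<open>(0 : a\<^sup>i)\<close> stops, say at \<open>k\<close>, so that
  \<open>(0 : a)\<close> meets \<open>a\<^sup>k M\<close> only in zero; and as \<open>M/aM\<close> has finite length, some power of \<open>\<mm>\<close>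
  maps \<open>M\<close> into \<open>aM\<close>, hence a higher power maps \<open>M\<close> into \<open>a\<^sup>k M\<close>.

  The summand \<open>(0 : a)\<close> is nonzero because \<open>M\<close> has depth zero
  (\<open>depth_zero_imp_elt_torsion_nonzero\<close>), and so it is not inside \<open>bM \<subseteq> dM\<close>. If \<open>dM\<close> were
  equal to \<open>bM = a dM\<close>, it would vanish by Nakayama's lemma (\<open>nakayama_elt_smult\<close>). Then
  \<open>bM = 0\<close>, so \<open>M\<close> itself would have finite length, and its dimension would be zero instead of one
  (\<open>annihilated_imp_dim_zero\<close>).
\<close>

section \<open>Submodules, spans and quotients\<close>

text \<open>The colon submodule \<open>(0 :\<^sub>M a)\<close>.\<close>

definition elt_torsion :: "'a \<Rightarrow> ('a, 'b, 'm) module_scheme \<Rightarrow> 'b set" where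
  "elt_torsion a M = {x \<in> carrier M. a \<odot>\<^bsub>M\<^esub> x = \<zero>\<^bsub>M\<^esub>}"

definition cyclic_submodule ::
    "('a, 'r) ring_scheme \<Rightarrow> ('a, 'b, 'm) module_scheme \<Rightarrow> 'b \<Rightarrow> 'b set" where
  "cyclic_submodule R M x = {r \<odot>\<^bsub>M\<^esub> x | r. r \<in> carrier R}"

context module
begin

lemma submodule_carrier: "submodule N R M \<Longrightarrow> x \<in> N \<Longrightarrow> x \<in> carrier M"
  using submoduleE(1) by blast

lemma submodule_zero: "submodule N R M \<Longrightarrow> \<zero>\<^bsub>M\<^esub> \<in> N"
  using subgroup.one_closed[OF submodule.axioms(1)] by fastforce

lemma submodule_diff:
  "submodule N R M \<Longrightarrow> x \<in> N \<Longrightarrow> y \<in> N \<Longrightarrow> x \<ominus>\<^bsub>M\<^esub> y \<in> N"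
  unfolding a_minus_def by (simp add: submoduleE(3,5))

lemma diff_eqI:
  "x = u \<oplus>\<^bsub>M\<^esub> v \<Longrightarrow> u \<in> carrier M \<Longrightarrow> v \<in> carrier M \<Longrightarrow> x \<ominus>\<^bsub>M\<^esub> u = v"
  by (simp add: M.minus_eq M.a_comm[of u v] M.a_assoc M.r_neg)

lemma zero_submodule: "submodule {\<zero>\<^bsub>M\<^esub>} R M"
  by (rule submoduleI) auto

lemma elt_torsion_submodule:
  assumes "a \<in> carrier R" shows "submodule (elt_torsion a M) R M"
proof (rule submoduleI)
  fix r x assume "r \<in> carrier R" "x \<in> elt_torsion a M"
  then show "r \<odot>\<^bsub>M\<^esub> x \<in> elt_torsion a M"
    using assms unfolding elt_torsion_def
    by (auto simp: smult_assoc1[symmetric] R.m_comm[of a r]) (simp add: smult_assoc1)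
qed (use assms in \<open>auto simp: elt_torsion_def smult_r_minus smult_r_distr\<close>)

lemma cyclic_submodule_submodule:
  assumes "x \<in> carrier M" shows "submodule (cyclic_submodule R M x) R M"
proof (rule submoduleI)
  show "\<zero>\<^bsub>M\<^esub> \<in> cyclic_submodule R M x"
    unfolding cyclic_submodule_def using assms smult_l_null by (metis (mono_tags, lifting) R.zero_closed mem_Collect_eq)
next
  fix y assume "y \<in> cyclic_submodule R M x"
  then obtain r where "r \<in> carrier R" "y = r \<odot>\<^bsub>M\<^esub> x" unfolding cyclic_submodule_def by blast
  then have "\<ominus>\<^bsub>M\<^esub> y = (\<ominus> r) \<odot>\<^bsub>M\<^esub> x" "\<ominus> r \<in> carrier R" using assms by (simp_all add: smult_l_minus)
  then show "\<ominus>\<^bsub>M\<^esub> y \<in> cyclic_submodule R M x" unfolding cyclic_submodule_def by blast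
next
  fix y z assume "y \<in> cyclic_submodule R M x" "z \<in> cyclic_submodule R M x"
  then obtain r s where "r \<in> carrier R" "y = r \<odot>\<^bsub>M\<^esub> x" "s \<in> carrier R" "z = s \<odot>\<^bsub>M\<^esub> x"
    unfolding cyclic_submodule_def by blast
  then have "y \<oplus>\<^bsub>M\<^esub> z = (r \<oplus> s) \<odot>\<^bsub>M\<^esub> x" "r \<oplus> s \<in> carrier R" using assms by (simp_all add: smult_l_distr)
  then show "y \<oplus>\<^bsub>M\<^esub> z \<in> cyclic_submodule R M x" unfolding cyclic_submodule_def by blast
next
  fix s y assume s: "s \<in> carrier R" and "y \<in> cyclic_submodule R M x"
  then obtain r where "r \<in> carrier R" "y = r \<odot>\<^bsub>M\<^esub> x" unfolding cyclic_submodule_def by blast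
  then have "s \<odot>\<^bsub>M\<^esub> y = (s \<otimes> r) \<odot>\<^bsub>M\<^esub> x" "s \<otimes> r \<in> carrier R" using assms s by (simp_all add: smult_assoc1)
  then show "s \<odot>\<^bsub>M\<^esub> y \<in> cyclic_submodule R M x" unfolding cyclic_submodule_def by blast
qed (use assms in \<open>auto simp: cyclic_submodule_def\<close>)

lemma cyclic_submodule_self: "x \<in> carrier M \<Longrightarrow> x \<in> cyclic_submodule R M x"
  unfolding cyclic_submodule_def using smult_one by (metis (mono_tags, lifting) R.one_closed mem_Collect_eq)

lemma cyclic_submodule_minimal:
  "submodule N R M \<Longrightarrow> x \<in> N \<Longrightarrow> cyclic_submodule R M x \<subseteq> N"
  unfolding cyclic_submodule_def using submoduleE(4) by blast

lemma submodule_span_superset: "T \<subseteq> submodule_span R M T"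
  unfolding submodule_span_def by blast

lemma submodule_span_minimal:
  "submodule N R M \<Longrightarrow> T \<subseteq> N \<Longrightarrow> submodule_span R M T \<subseteq> N"
  unfolding submodule_span_def by blast

lemmas span_submodule = submodule_span_submodule[OF module_axioms]

lemma submodule_span_empty: "submodule_span R M {} = {\<zero>\<^bsub>M\<^esub>}"
proof
  show "submodule_span R M {} \<subseteq> {\<zero>\<^bsub>M\<^esub>}"
    by (rule submodule_span_minimal[OF zero_submodule]) simp
  show "{\<zero>\<^bsub>M\<^esub>} \<subseteq> submodule_span R M {}"
    using submodule_zero[OF span_submodule] by simp
qed

text \<open>The elements of the stated form already make up a submodule containing \<open>t\<close> and \<open>T\<close>. This
  is what inductions on the number of generators use in place of finite linear combinations.\<close>

lemma submodule_span_insertE: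
  assumes "t \<in> carrier M" "T \<subseteq> carrier M" "x \<in> submodule_span R M (insert t T)"
  obtains r y where "r \<in> carrier R" "y \<in> submodule_span R M T" "x = r \<odot>\<^bsub>M\<^esub> t \<oplus>\<^bsub>M\<^esub> y"
proof -
  define S where "S = submodule_span R M T"
  define N where "N = {r \<odot>\<^bsub>M\<^esub> t \<oplus>\<^bsub>M\<^esub> y | r y. r \<in> carrier R \<and> y \<in> S}"
  have S: "submodule S R M" "T \<subseteq> S"
    unfolding S_def using span_submodule[OF assms(2)] submodule_span_superset by blast+
  note Sc = submodule_carrier[OF S(1)]
  have N_I: "r \<odot>\<^bsub>M\<^esub> t \<oplus>\<^bsub>M\<^esub> y \<in> N" if "r \<in> carrier R" "y \<in> S" for r y
    using that unfolding N_def by blast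
  have "submodule N R M"
  proof (rule submoduleI)
    show "N \<subseteq> carrier M" using Sc assms(1) unfolding N_def by auto
    show "\<zero>\<^bsub>M\<^esub> \<in> N" using N_I[OF R.zero_closed submodule_zero[OF S(1)]] assms(1) by simp
  next
    fix u assume "u \<in> N"
    then obtain r y where u: "r \<in> carrier R" "y \<in> S" "u = r \<odot>\<^bsub>M\<^esub> t \<oplus>\<^bsub>M\<^esub> y" unfolding N_def by blast
    then have "\<ominus>\<^bsub>M\<^esub> u = (\<ominus> r) \<odot>\<^bsub>M\<^esub> t \<oplus>\<^bsub>M\<^esub> (\<ominus>\<^bsub>M\<^esub> y)"
      using assms(1) Sc by (simp add: smult_l_minus M.minus_add)
    then show "\<ominus>\<^bsub>M\<^esub> u \<in> N" using N_I[of "\<ominus> r" "\<ominus>\<^bsub>M\<^esub> y"] u submoduleE(3)[OF S(1)] by simp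
  next
    fix u v assume "u \<in> N" "v \<in> N"
    then obtain r y s z where u: "r \<in> carrier R" "y \<in> S" "u = r \<odot>\<^bsub>M\<^esub> t \<oplus>\<^bsub>M\<^esub> y"
      "s \<in> carrier R" "z \<in> S" "v = s \<odot>\<^bsub>M\<^esub> t \<oplus>\<^bsub>M\<^esub> z" unfolding N_def by blast
    then have "u \<oplus>\<^bsub>M\<^esub> v = (r \<oplus> s) \<odot>\<^bsub>M\<^esub> t \<oplus>\<^bsub>M\<^esub> (y \<oplus>\<^bsub>M\<^esub> z)"
      using assms(1) Sc by (simp add: smult_l_distr M.a_ac)
    then show "u \<oplus>\<^bsub>M\<^esub> v \<in> N" using N_I[of "r \<oplus> s" "y \<oplus>\<^bsub>M\<^esub> z"] u submoduleE(5)[OF S(1)] by simp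
  next
    fix s u assume s: "s \<in> carrier R" and "u \<in> N"
    then obtain r y where u: "r \<in> carrier R" "y \<in> S" "u = r \<odot>\<^bsub>M\<^esub> t \<oplus>\<^bsub>M\<^esub> y" unfolding N_def by blast
    then have "s \<odot>\<^bsub>M\<^esub> u = (s \<otimes> r) \<odot>\<^bsub>M\<^esub> t \<oplus>\<^bsub>M\<^esub> s \<odot>\<^bsub>M\<^esub> y"
      using assms(1) Sc s by (simp add: smult_r_distr smult_assoc1)
    then show "s \<odot>\<^bsub>M\<^esub> u \<in> N" using N_I[of "s \<otimes> r" "s \<odot>\<^bsub>M\<^esub> y"] u s submoduleE(4)[OF S(1)] by simp
  qed
  moreover have "insert t T \<subseteq> N"
  proof -
    have "t \<in> N" using N_I[OF R.one_closed submodule_zero[OF S(1)]] assms(1) by simp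
    moreover have "y \<in> N" if "y \<in> T" for y
      using N_I[OF R.zero_closed, of y] that S Sc assms(1) by (auto simp: subset_iff)
    ultimately show ?thesis by blast
  qed
  ultimately have "x \<in> N" using submodule_span_minimal assms(3) by blast
  then show thesis using that unfolding N_def S_def by blast
qed

lemma carrier_quotient:
  "carrier (quotient_module M N) = (\<lambda>x. N +>\<^bsub>M\<^esub> x) ` carrier M"
  by (auto simp: quotient_module_def A_RCOSETS_def')

lemma zero_quotient: "\<zero>\<^bsub>quotient_module M N\<^esub> = N"
  by (simp add: quotient_module_def)

lemma add_quotient:
  assumes "submodule N R M" "x \<in> carrier M" "y \<in> carrier M"
  shows "(N +>\<^bsub>M\<^esub> x) \<oplus>\<^bsub>quotient_module M N\<^esub> (N +>\<^bsub>M\<^esub> y) = N +>\<^bsub>M\<^esub> (x \<oplus>\<^bsub>M\<^esub> y)"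
proof -
  interpret A: abelian_subgroup N M using submodule_coset[OF module_axioms assms(1)] .
  show ?thesis using A.a_rcos_sum assms by (simp add: quotient_module_def)
qed

lemmas smult_quotient = quotient_smult[OF module_axioms]

lemma coset_eq_iff:
  assumes "submodule N R M" "x \<in> carrier M" "y \<in> carrier M"
  shows "N +>\<^bsub>M\<^esub> x = N +>\<^bsub>M\<^esub> y \<longleftrightarrow> x \<ominus>\<^bsub>M\<^esub> y \<in> N"
proof -
  interpret A: abelian_subgroup N M using submodule_coset[OF module_axioms assms(1)] .
  show ?thesis
    using A.a_rcos_module[OF assms(3,2)] assms
      A.a_rcos_self A.a_repr_independence' unfolding a_minus_def by metis
qed

lemma coset_eq_zero_iff:
  assumes "submodule N R M" "x \<in> carrier M"
  shows "N +>\<^bsub>M\<^esub> x = N \<longleftrightarrow> x \<in> N"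
proof -
  interpret A: abelian_subgroup N M using submodule_coset[OF module_axioms assms(1)] .
  show ?thesis using A.a_rcos_const A.a_rcos_self[OF assms(2)] by auto
qed

lemma coset_image_submodule:
  assumes N: "submodule N R M" and L: "submodule L R M"
  shows "submodule ((\<lambda>x. N +>\<^bsub>M\<^esub> x) ` L) R (quotient_module M N)"
proof -
  interpret Q: module R "quotient_module M N" using quotient_module_module[OF module_axioms N] .
  note Lc = submodule_carrier[OF L]
  have neg: "\<ominus>\<^bsub>quotient_module M N\<^esub> (N +>\<^bsub>M\<^esub> x) = N +>\<^bsub>M\<^esub> (\<ominus>\<^bsub>M\<^esub> x)" if "x \<in> carrier M" for x
    using that Q.M.minus_equality[of "N +>\<^bsub>M\<^esub> (\<ominus>\<^bsub>M\<^esub> x)" "N +>\<^bsub>M\<^esub> x"]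
    by (simp add: add_quotient[OF N] carrier_quotient zero_quotient coset_eq_zero_iff[OF N]
        submodule_zero[OF N] M.l_neg)
  show ?thesis
  proof (rule Q.submoduleI)
    show "(\<lambda>x. N +>\<^bsub>M\<^esub> x) ` L \<subseteq> carrier (quotient_module M N)"
      using Lc by (auto simp: carrier_quotient)
    show "\<zero>\<^bsub>quotient_module M N\<^esub> \<in> (\<lambda>x. N +>\<^bsub>M\<^esub> x) ` L"
      using coset_eq_zero_iff[OF N M.zero_closed] submodule_zero[OF N] submodule_zero[OF L]
      by (auto simp: zero_quotient intro!: image_eqI[where x="\<zero>\<^bsub>M\<^esub>"])
  next
    fix X assume "X \<in> (\<lambda>x. N +>\<^bsub>M\<^esub> x) ` L"
    then show "\<ominus>\<^bsub>quotient_module M N\<^esub> X \<in> (\<lambda>x. N +>\<^bsub>M\<^esub> x) ` L"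
      using Lc neg submoduleE(3)[OF L] by auto
  next
    fix X Y assume "X \<in> (\<lambda>x. N +>\<^bsub>M\<^esub> x) ` L" "Y \<in> (\<lambda>x. N +>\<^bsub>M\<^esub> x) ` L"
    then show "X \<oplus>\<^bsub>quotient_module M N\<^esub> Y \<in> (\<lambda>x. N +>\<^bsub>M\<^esub> x) ` L"
      using Lc submoduleE(5)[OF L] by (auto simp: add_quotient[OF N])
  next
    fix r X assume "r \<in> carrier R" "X \<in> (\<lambda>x. N +>\<^bsub>M\<^esub> x) ` L"
    then show "r \<odot>\<^bsub>quotient_module M N\<^esub> X \<in> (\<lambda>x. N +>\<^bsub>M\<^esub> x) ` L"
      using Lc submoduleE(4)[OF L] by (auto simp: smult_quotient[OF N])
  qed
qed

end

section \<open>Local rings, powers of the maximal ideal and Nakayama's lemma\<close>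

context cring
begin

text \<open>In a commutative ring one-sided multiplicative closure suffices, and it also yields negatives,
  through multiplication by \<open>-1\<close>.\<close>

lemma ideal_criterion:
  assumes sub: "I \<subseteq> carrier R" and zero: "\<zero> \<in> I"
    and add: "\<And>r s. r \<in> I \<Longrightarrow> s \<in> I \<Longrightarrow> r \<oplus> s \<in> I"
    and mult: "\<And>r s. r \<in> I \<Longrightarrow> s \<in> carrier R \<Longrightarrow> s \<otimes> r \<in> I"
  shows "ideal I R"
proof (rule idealI[OF ring_axioms])
  show "x \<otimes> a \<in> I" "a \<otimes> x \<in> I" if "a \<in> I" "x \<in> carrier R" for a x
    using mult[OF that] m_comm[of a x] sub that by auto
  have "\<ominus> a \<in> I" if "a \<in> I" for a
    using mult[OF that, of "\<ominus> \<one>"] sub that by (auto simp: l_minus)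
  then show "subgroup I (add_monoid R)"
    by (intro add.subgroupI) (use sub zero add in \<open>auto simp: a_inv_def\<close>)
qed

lemma ideal_pow_0 [simp]: "ideal_pow R I 0 = carrier R"
  by (simp add: ideal_pow_def ideals_set_def)

lemma ideal_pow_Suc: "ideal_pow R I (Suc k) = ideal_pow R I k \<cdot> I"
  by (simp add: ideal_pow_def ideals_set_def)

lemma ideal_pow_ideal: "ideal I R \<Longrightarrow> ideal (ideal_pow R I k) R"
  by (induct k) (simp_all add: oneideal ideal_pow_Suc ideal_prod_is_ideal)

lemma ideal_pow_add:
  assumes "ideal I R"
  shows "ideal_pow R I (i + j) = ideal_pow R I i \<cdot> ideal_pow R I j"
proof -
  interpret S: comm_monoid "ideals_set R" by (rule ideals_set_is_comm_monoid)
  show ?thesis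
    using S.nat_pow_mult[of I i j] assms by (simp add: ideal_pow_def ideals_set_def)
qed

lemma ideal_pow_Suc_subset: "ideal I R \<Longrightarrow> ideal_pow R I (Suc k) \<subseteq> ideal_pow R I k"
  using ideal_prod_inter[OF ideal_pow_ideal[of I k]] by (auto simp: ideal_pow_Suc)

lemma nat_pow_in_ideal_pow:
  "r \<in> I \<Longrightarrow> r [^] k \<in> ideal_pow R I k"
  by (induct k) (auto simp: ideal_pow_Suc intro: ideal_prod.prod)

end

context local_ring
begin

sublocale max: maximalideal \<mm> R by (rule maximal)

text \<open>By Zorn's lemma the ideals that contain \<open>r\<close> but not \<open>1\<close> have a maximal member; being a maximal
  ideal, it has to be \<open>\<mm>\<close>.\<close>

lemma nonunit_in_maximal_ideal:
  assumes "r \<in> carrier R" "r \<notin> Units R"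
  shows "r \<in> \<mm>"
proof -
  define S where "S = {I. ideal I R \<and> r \<in> I \<and> \<one> \<notin> I}"
  have "PIdl r \<in> S"
    using assms cgenideal_ideal cgenideal_self ideal_eq_carrier_iff ideal.one_imp_carrier
    unfolding S_def by fastforce
  have "\<exists>J\<in>S. \<forall>I\<in>S. J \<subseteq> I \<longrightarrow> I = J"
  proof (rule subset_Zorn_nonempty)
    show "S \<noteq> {}" using \<open>PIdl r \<in> S\<close> by blast
    fix C assume C: "C \<noteq> {}" "subset.chain S C"
    then have "subset.chain {I. ideal I R} C"
      unfolding pred_on.chain_def S_def by blast
    from chain_Union_is_ideal[OF this] C show "\<Union>C \<in> S"
      unfolding S_def pred_on.chain_def by auto
  qed
  then obtain J where J: "J \<in> S" "\<And>I. I \<in> S \<Longrightarrow> J \<subseteq> I \<Longrightarrow> I = J" by blast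
  have "maximalideal J R"
  proof (rule maximalidealI)
    show "ideal J R" "carrier R \<noteq> J" using J(1) unfolding S_def by auto
    fix I assume "ideal I R" "J \<subseteq> I" "I \<subseteq> carrier R"
    then show "I = J \<or> I = carrier R"
      using J ideal.one_imp_carrier unfolding S_def by blast
  qed
  then show ?thesis using unique J(1) unfolding S_def by blast
qed

lemma one_minus_unit:
  assumes "r \<in> \<mm>" shows "\<one> \<ominus> r \<in> Units R"
proof (rule ccontr)
  note r = max.Icarr[OF assms]
  assume "\<one> \<ominus> r \<notin> Units R"
  then have "\<one> \<ominus> r \<in> \<mm>"
    by (rule nonunit_in_maximal_ideal[rotated]) (use r in simp)
  then have "(\<one> \<ominus> r) \<oplus> r \<in> \<mm>" using assms by (rule max.a_closed)
  moreover have "(\<one> \<ominus> r) \<oplus> r = \<one>" using r by (simp add: minus_eq a_assoc l_neg)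
  ultimately show False using max.one_imp_carrier max.I_notcarr by auto
qed

end

locale local_ring_module = module R M + local_ring R \<mm>
  for R (structure) and \<mm> and M (structure)
begin

text \<open>The core of Nakayama's lemma: \<open>(1 - r) x\<close> lies in \<open>N\<close> and \<open>1 - r\<close> is a unit. For \<open>N = 0\<close> it says that
  \<open>x = r x\<close> with \<open>r \<in> \<mm>\<close> forces \<open>x = 0\<close>.\<close>

lemma smult_congruent_imp_mem:
  assumes "r \<in> \<mm>" "x \<in> carrier M" "submodule N R M" "x \<ominus>\<^bsub>M\<^esub> r \<odot>\<^bsub>M\<^esub> x \<in> N"
  shows "x \<in> N"
proof -
  have r: "r \<in> carrier R" using assms(1) by (rule max.Icarr)
  note u = one_minus_unit[OF assms(1)]
  have "(\<one> \<ominus> r) \<odot>\<^bsub>M\<^esub> x = x \<ominus>\<^bsub>M\<^esub> r \<odot>\<^bsub>M\<^esub> x"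
    using r assms(2) by (simp add: R.minus_eq M.minus_eq smult_l_distr smult_l_minus)
  then have "inv (\<one> \<ominus> r) \<odot>\<^bsub>M\<^esub> ((\<one> \<ominus> r) \<odot>\<^bsub>M\<^esub> x) \<in> N"
    using submoduleE(4)[OF assms(3) Units_inv_closed[OF u] assms(4)] by simp
  also have "inv (\<one> \<ominus> r) \<odot>\<^bsub>M\<^esub> ((\<one> \<ominus> r) \<odot>\<^bsub>M\<^esub> x) = x"
    using u assms(2) r by (simp flip: smult_assoc1)
  finally show ?thesis .
qed

text \<open>Nakayama's lemma for a single multiplier. A generator \<open>t\<close> can be written as
  \<open>a (r t + y)\<close> with \<open>y\<close> in the span of the other generators, so \<open>(1 - a r) t\<close> lies in that span, and
  with it \<open>t\<close>. Thus generators can be discarded one by one.\<close>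

lemma nakayama_span:
  assumes "finite T" "T \<subseteq> carrier M" "a \<in> \<mm>"
    and "submodule_span R M T \<subseteq> (\<lambda>y. a \<odot>\<^bsub>M\<^esub> y) ` submodule_span R M T"
  shows "submodule_span R M T = {\<zero>\<^bsub>M\<^esub>}"
  using assms(1,2,4)
proof (induct T rule: finite_induct)
  case empty
  show ?case by (rule submodule_span_empty)
next
  case (insert t T)
  have t: "t \<in> carrier M" and T: "T \<subseteq> carrier M" using insert.prems by auto
  have a: "a \<in> carrier R" using assms(3) by (rule max.Icarr)
  note S = span_submodule[OF T]
  have "t \<in> submodule_span R M (insert t T)" using submodule_span_superset by blast
  then obtain z where z: "z \<in> submodule_span R M (insert t T)" "t = a \<odot>\<^bsub>M\<^esub> z"
    using insert.prems(2) by blast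
  obtain r y where r: "r \<in> carrier R" "y \<in> submodule_span R M T" "z = r \<odot>\<^bsub>M\<^esub> t \<oplus>\<^bsub>M\<^esub> y"
    using submodule_span_insertE[OF t T z(1)] .
  have y: "y \<in> carrier M" using submodule_carrier[OF S r(2)] .
  have "t = (a \<otimes> r) \<odot>\<^bsub>M\<^esub> t \<oplus>\<^bsub>M\<^esub> a \<odot>\<^bsub>M\<^esub> y"
    using z(2) r a y t by (simp add: smult_r_distr smult_assoc1)
  then have "t \<ominus>\<^bsub>M\<^esub> (a \<otimes> r) \<odot>\<^bsub>M\<^esub> t = a \<odot>\<^bsub>M\<^esub> y"
    by (rule diff_eqI) (use a r(1) t y in simp_all)
  then have "t \<ominus>\<^bsub>M\<^esub> (a \<otimes> r) \<odot>\<^bsub>M\<^esub> t \<in> submodule_span R M T"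
    using submoduleE(4)[OF S a r(2)] by simp
  then have "t \<in> submodule_span R M T"
    using smult_congruent_imp_mem[OF _ t S] max.I_r_closed[OF assms(3) r(1)] by blast
  then have eq: "submodule_span R M (insert t T) = submodule_span R M T"
    using submodule_span_minimal[OF S, of "insert t T"] submodule_span_superset[of T]
      submodule_span_minimal[OF span_submodule[OF insert.prems(1)], of T]
      submodule_span_superset[of "insert t T"] by blast
  show ?case using insert.hyps(3)[OF T] insert.prems(2) unfolding eq by blast
qed

text \<open>If \<open>M\<close> is generated by \<open>S\<close>, then \<open>dM\<close> is generated by the multiples \<open>d x\<close> for \<open>x \<in> S\<close>, so it is again
  finitely generated. The hypothesis amounts to \<open>dM = a dM\<close>.\<close>

lemma nakayama_elt_smult:
  assumes fg: "finitely_generated R M" and d: "d \<in> carrier R" and a: "a \<in> \<mm>"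
    and sub: "elt_smult d M \<subseteq> elt_smult (d \<otimes> a) M"
  shows "elt_smult d M = {\<zero>\<^bsub>M\<^esub>}"
proof -
  obtain S where S: "finite S" "S \<subseteq> carrier M" "submodule_span R M S = carrier M"
    using fg unfolding finitely_generated_def by blast
  define T where "T = (\<lambda>x. d \<odot>\<^bsub>M\<^esub> x) ` S"
  have ac: "a \<in> carrier R" using a by (rule max.Icarr)
  have T: "finite T" "T \<subseteq> carrier M" using S d unfolding T_def by auto
  note dM = elt_smult_submodule[OF module_axioms d]
  note sT = span_submodule[OF T(2)]
  have span: "submodule_span R M T = elt_smult d M"
  proof
    show "submodule_span R M T \<subseteq> elt_smult d M"
      by (rule submodule_span_minimal[OF dM]) (use S in \<open>auto simp: T_def elt_smult_def\<close>)
    define N where "N = {x \<in> carrier M. d \<odot>\<^bsub>M\<^esub> x \<in> submodule_span R M T}"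
    have "submodule N R M"
    proof (rule submoduleI)
      fix r x assume r: "r \<in> carrier R" "x \<in> N"
      then have "r \<odot>\<^bsub>M\<^esub> (d \<odot>\<^bsub>M\<^esub> x) \<in> submodule_span R M T"
        using submoduleE(4)[OF sT] unfolding N_def by blast
      also have "r \<odot>\<^bsub>M\<^esub> (d \<odot>\<^bsub>M\<^esub> x) = d \<odot>\<^bsub>M\<^esub> (r \<odot>\<^bsub>M\<^esub> x)"
        using r d R.m_comm unfolding N_def by (simp flip: smult_assoc1)
      finally show "r \<odot>\<^bsub>M\<^esub> x \<in> N" using r unfolding N_def by simp
    qed (use d submodule_zero[OF sT] submoduleE(3,5)[OF sT]
          in \<open>auto simp: N_def smult_r_minus smult_r_distr\<close>)
    moreover have "S \<subseteq> N" using S(2) submodule_span_superset[of T] unfolding N_def T_def by auto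
    ultimately have "carrier M \<subseteq> N" using submodule_span_minimal S(3) by metis
    then show "elt_smult d M \<subseteq> submodule_span R M T" unfolding N_def elt_smult_def by blast
  qed
  have "elt_smult d M \<subseteq> (\<lambda>y. a \<odot>\<^bsub>M\<^esub> y) ` elt_smult d M"
  proof
    fix x assume "x \<in> elt_smult d M"
    then obtain z where "z \<in> carrier M" "x = (d \<otimes> a) \<odot>\<^bsub>M\<^esub> z"
      using sub unfolding elt_smult_def by blast
    then show "x \<in> (\<lambda>y. a \<odot>\<^bsub>M\<^esub> y) ` elt_smult d M"
      using d ac R.m_comm[OF d ac] by (auto simp: elt_smult_def smult_assoc1)
  qed
  then show ?thesis using nakayama_span[OF T a] span by simp
qed

end

section \<open>Finite length\<close>

lemma chain_height_upper:
  assumes "Cs \<noteq> []" "sorted_wrt (\<subset>) Cs" "set Cs \<subseteq> \<C>"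
  shows "enat (length Cs - 1) \<le> chain_height \<C>"
  unfolding chain_height_def by (rule SUP_upper) (use assms in simp)

context local_ring_module
begin

text \<open>If \<open>\<mm>\<^sup>k\<close> does not kill \<open>x\<close>, then some product \<open>t\<^sub>1 \<dots> t\<^sub>k\<close> of elements of \<open>\<mm>\<close> does not,
  and the cyclic submodules \<open>Rx \<supset> Rt\<^sub>kx \<supset> \<dots> \<supset> 0\<close> strictly decrease: an equality
  \<open>Ry = Rty\<close> would give \<open>y = q t y\<close> and hence \<open>y = 0\<close>. Together with the zero submodule at the bottom
  they form a chain of length \<open>k + 1\<close>, so a module of length \<open>k\<close> is killed by \<open>\<mm>\<^sup>k\<close>.\<close>

lemma submodule_chain_if_not_annihilated:
  assumes "x \<in> carrier M" "r \<in> ideal_pow R \<mm> k" "r \<odot>\<^bsub>M\<^esub> x \<noteq> \<zero>\<^bsub>M\<^esub>"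
  shows "\<exists>Cs. length Cs = Suc k \<and> set Cs \<subseteq> {N. submodule N R M} \<and>
    sorted_wrt (\<subset>) (Cs @ [cyclic_submodule R M x])"
  using assms
proof (induct k arbitrary: x r)
  case 0
  then have "x \<noteq> \<zero>\<^bsub>M\<^esub>" by auto
  then have "{\<zero>\<^bsub>M\<^esub>} \<subset> cyclic_submodule R M x"
    using 0(1) cyclic_submodule_self submodule_zero[OF cyclic_submodule_submodule] by auto
  then show ?case using zero_submodule by (intro exI[of _ "[{\<zero>\<^bsub>M\<^esub>}]"]) simp
next
  case (Suc k)
  have "\<exists>s\<in>ideal_pow R \<mm> k. \<exists>t\<in>\<mm>. s \<odot>\<^bsub>M\<^esub> (t \<odot>\<^bsub>M\<^esub> x) \<noteq> \<zero>\<^bsub>M\<^esub>"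
  proof (rule ccontr)
    assume *: "\<not> ?thesis"
    note Pc = ideal.Icarr[OF ideal_pow_ideal[OF max.is_ideal]]
    have "q \<in> carrier R \<and> q \<odot>\<^bsub>M\<^esub> x = \<zero>\<^bsub>M\<^esub>" if "q \<in> ideal_pow R \<mm> k \<cdot> \<mm>" for q
      using that
    proof (induct q rule: ideal_prod.induct)
      case (prod i j)
      then show ?case using * Pc max.Icarr Suc(2) by (auto simp: smult_assoc1)
    next
      case (sum u v)
      then show ?case using Suc(2) by (simp add: smult_l_distr)
    qed
    then show False using Suc(3,4) unfolding ideal_pow_Suc by blast
  qed
  then obtain s t where st: "s \<in> ideal_pow R \<mm> k" "t \<in> \<mm>" "s \<odot>\<^bsub>M\<^esub> (t \<odot>\<^bsub>M\<^esub> x) \<noteq> \<zero>\<^bsub>M\<^esub>"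
    by blast
  define y where "y = t \<odot>\<^bsub>M\<^esub> x"
  have t: "t \<in> carrier R" using st(2) by (rule max.Icarr)
  then have y: "y \<in> carrier M" using Suc(2) unfolding y_def by simp
  obtain Cs where Cs: "length Cs = Suc k" "set Cs \<subseteq> {N. submodule N R M}"
    "sorted_wrt (\<subset>) (Cs @ [cyclic_submodule R M y])"
    using Suc(1)[OF y st(1)] st(3) unfolding y_def by blast
  have "cyclic_submodule R M y \<subseteq> cyclic_submodule R M x"
    by (rule cyclic_submodule_minimal[OF cyclic_submodule_submodule[OF Suc(2)]])
      (use t in \<open>auto simp: y_def cyclic_submodule_def\<close>)
  moreover have "cyclic_submodule R M y \<noteq> cyclic_submodule R M x"
  proof
    assume "cyclic_submodule R M y = cyclic_submodule R M x"
    then obtain q where q: "q \<in> carrier R" "x = q \<odot>\<^bsub>M\<^esub> y"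
      using cyclic_submodule_self[OF Suc(2)] unfolding cyclic_submodule_def by blast
    then have "x = (q \<otimes> t) \<odot>\<^bsub>M\<^esub> x" using t Suc(2) unfolding y_def by (simp add: smult_assoc1)
    then have "x \<ominus>\<^bsub>M\<^esub> (q \<otimes> t) \<odot>\<^bsub>M\<^esub> x = \<zero>\<^bsub>M\<^esub>"
      by (intro diff_eqI) (use q t Suc(2) in simp_all)
    then have "x = \<zero>\<^bsub>M\<^esub>"
      using smult_congruent_imp_mem[OF max.I_l_closed[OF st(2) q(1)] Suc(2) zero_submodule] by simp
    then show False using st Suc(2) t ideal.Icarr[OF ideal_pow_ideal[OF max.is_ideal] st(1)] by simp
  qed
  ultimately have "cyclic_submodule R M y \<subset> cyclic_submodule R M x" by blast
  then show ?case
    using Cs cyclic_submodule_submodule[OF y]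
    by (intro exI[of _ "Cs @ [cyclic_submodule R M y]"]) (auto simp: sorted_wrt_append)
qed

lemma finite_length_imp_annihilated:
  assumes "finite_length R M"
  shows "\<exists>k. \<forall>r\<in>ideal_pow R \<mm> k. \<forall>x\<in>carrier M. r \<odot>\<^bsub>M\<^esub> x = \<zero>\<^bsub>M\<^esub>"
proof -
  obtain k where k: "chain_height {N. submodule N R M} = enat k"
    using assms unfolding finite_length_def module_length_def by auto
  have "r \<odot>\<^bsub>M\<^esub> x = \<zero>\<^bsub>M\<^esub>" if r: "r \<in> ideal_pow R \<mm> k" and x: "x \<in> carrier M" for r x
  proof (rule ccontr)
    assume "r \<odot>\<^bsub>M\<^esub> x \<noteq> \<zero>\<^bsub>M\<^esub>"
    then obtain Cs where Cs: "length Cs = Suc k" "set Cs \<subseteq> {N. submodule N R M}"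
      "sorted_wrt (\<subset>) (Cs @ [cyclic_submodule R M x])"
      using submodule_chain_if_not_annihilated[OF x r] by blast
    have "enat (Suc k) \<le> enat k"
      using chain_height_upper[OF _ Cs(3), of "{N. submodule N R M}"] Cs(1,2) k
        cyclic_submodule_submodule[OF x] by simp
    then show False by simp
  qed
  then show ?thesis by blast
qed

lemma finite_length_quotient_imp_ideal_pow_smult:
  assumes N: "submodule N R M" and "finite_length R (quotient_module M N)"
  shows "\<exists>k. \<forall>r\<in>ideal_pow R \<mm> k. \<forall>x\<in>carrier M. r \<odot>\<^bsub>M\<^esub> x \<in> N"
proof -
  interpret Q: module R "quotient_module M N" using quotient_module_module[OF module_axioms N] .
  interpret Q: local_ring_module R \<mm> "quotient_module M N" ..
  obtain k where k: "\<And>r X. r \<in> ideal_pow R \<mm> k \<Longrightarrow> X \<in> carrier (quotient_module M N) \<Longrightarrow>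
      r \<odot>\<^bsub>quotient_module M N\<^esub> X = \<zero>\<^bsub>quotient_module M N\<^esub>"
    using Q.finite_length_imp_annihilated[OF assms(2)] by blast
  have "r \<odot>\<^bsub>M\<^esub> x \<in> N" if r: "r \<in> ideal_pow R \<mm> k" and x: "x \<in> carrier M" for r x
  proof -
    have rc: "r \<in> carrier R" using ideal.Icarr[OF ideal_pow_ideal[OF max.is_ideal] r] .
    have "N +>\<^bsub>M\<^esub> (r \<odot>\<^bsub>M\<^esub> x) = N"
      using k[OF r, of "N +>\<^bsub>M\<^esub> x"] x by (simp add: carrier_quotient zero_quotient smult_quotient[OF N rc x])
    then show ?thesis using coset_eq_zero_iff[OF N] rc x by simp
  qed
  then show ?thesis by blast
qed

end

section \<open>Parameters and torsion\<close>

context module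
begin

text \<open>Ascending chain condition for finitely generated modules over a Noetherian ring, by induction on the
  generators. Adding a generator \<open>t\<close>, one looks at the ideals \<open>I i\<close> of those \<open>r\<close> for which some
  \<open>r t + y\<close>, with \<open>y\<close> in the span of the old generators, belongs to \<open>N i\<close>. They form an ascending
  chain as well. Once they and the traces of the \<open>N i\<close> on the old span are constant, so is
  \<open>N i\<close>.\<close>

lemma submodule_chain_stabilises:
  assumes "noetherian_ring R" "finite T" "T \<subseteq> carrier M"
    and sub: "\<And>i. submodule (N i) R M" and mono: "mono (N :: nat \<Rightarrow> 'c set)"
  shows "\<exists>k. \<forall>i. N i \<inter> submodule_span R M T \<subseteq> N k"
  using assms(2,3)
proof (induct T rule: finite_induct)
  case empty
  then show ?case using submodule_zero[OF sub] by (simp add: submodule_span_empty)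
next
  case (insert t T)
  have t: "t \<in> carrier M" and T: "T \<subseteq> carrier M" using insert.prems by auto
  note S = span_submodule[OF T]
  note Sc = submodule_carrier[OF S]
  obtain k1 where k1: "\<And>i. N i \<inter> submodule_span R M T \<subseteq> N k1"
    using insert.hyps(3)[OF T] by blast
  define I where "I i = {r \<in> carrier R. \<exists>y\<in>submodule_span R M T. r \<odot>\<^bsub>M\<^esub> t \<oplus>\<^bsub>M\<^esub> y \<in> N i}" for i
  have I_I: "r \<in> I i" if "r \<in> carrier R" "y \<in> submodule_span R M T" "r \<odot>\<^bsub>M\<^esub> t \<oplus>\<^bsub>M\<^esub> y \<in> N i" for r y i
    using that unfolding I_def by blast
  have ideal: "ideal (I i) R" for i
  proof (rule R.ideal_criterion)
    show "I i \<subseteq> carrier R" unfolding I_def by blast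
    show "\<zero> \<in> I i"
      using I_I[OF R.zero_closed submodule_zero[OF S]] submodule_zero[OF sub] t by simp
  next
    fix r s assume "r \<in> I i" and s: "s \<in> carrier R"
    then obtain y where y: "r \<in> carrier R" "y \<in> submodule_span R M T" "r \<odot>\<^bsub>M\<^esub> t \<oplus>\<^bsub>M\<^esub> y \<in> N i"
      unfolding I_def by blast
    have "s \<odot>\<^bsub>M\<^esub> (r \<odot>\<^bsub>M\<^esub> t \<oplus>\<^bsub>M\<^esub> y) \<in> N i" using submoduleE(4)[OF sub s y(3)] .
    also have "s \<odot>\<^bsub>M\<^esub> (r \<odot>\<^bsub>M\<^esub> t \<oplus>\<^bsub>M\<^esub> y) = (s \<otimes> r) \<odot>\<^bsub>M\<^esub> t \<oplus>\<^bsub>M\<^esub> s \<odot>\<^bsub>M\<^esub> y"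
      using s y t Sc by (simp add: smult_r_distr smult_assoc1)
    finally show "s \<otimes> r \<in> I i"
      by (rule I_I[rotated 2]) (use s y submoduleE(4)[OF S s] in simp_all)
  next
    fix r s assume "r \<in> I i" "s \<in> I i"
    then obtain y z where y: "r \<in> carrier R" "y \<in> submodule_span R M T" "r \<odot>\<^bsub>M\<^esub> t \<oplus>\<^bsub>M\<^esub> y \<in> N i"
      "s \<in> carrier R" "z \<in> submodule_span R M T" "s \<odot>\<^bsub>M\<^esub> t \<oplus>\<^bsub>M\<^esub> z \<in> N i"
      unfolding I_def by blast
    have "(r \<odot>\<^bsub>M\<^esub> t \<oplus>\<^bsub>M\<^esub> y) \<oplus>\<^bsub>M\<^esub> (s \<odot>\<^bsub>M\<^esub> t \<oplus>\<^bsub>M\<^esub> z) \<in> N i"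
      using submoduleE(5)[OF sub] y by blast
    also have "(r \<odot>\<^bsub>M\<^esub> t \<oplus>\<^bsub>M\<^esub> y) \<oplus>\<^bsub>M\<^esub> (s \<odot>\<^bsub>M\<^esub> t \<oplus>\<^bsub>M\<^esub> z) = (r \<oplus> s) \<odot>\<^bsub>M\<^esub> t \<oplus>\<^bsub>M\<^esub> (y \<oplus>\<^bsub>M\<^esub> z)"
      using y t Sc by (simp add: smult_l_distr M.a_ac)
    finally show "r \<oplus> s \<in> I i"
      by (rule I_I[rotated 2]) (use y submoduleE(5)[OF S] in simp_all)
  qed
  have mono_I: "mono I"
    by (rule monoI) (use mono in \<open>auto simp: I_def mono_def\<close>)
  have "\<Union>(range I) \<in> range I"
  proof (rule noetherian_ring.ideal_chain_is_trivial[OF assms(1)])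
    show "subset.chain {I. ideal I R} (range I)"
      unfolding subset_chain_def
    proof (intro conjI ballI)
      fix J J' assume "J \<in> range I" "J' \<in> range I"
      then obtain i j where "J = I i" "J' = I j" by blast
      then show "J \<subseteq> J' \<or> J' \<subseteq> J"
        using monoD[OF mono_I, of i j] monoD[OF mono_I, of j i] nat_le_linear[of i j] by blast
    qed (use ideal in auto)
  qed simp
  then obtain k2 where k2: "\<And>i. I i \<subseteq> I k2" by auto
  define k where "k = max k1 k2"
  have k: "N k1 \<subseteq> N k" "I k2 \<subseteq> I k"
    using mono mono_I unfolding k_def mono_def by simp_all
  have "x \<in> N k" if x: "x \<in> N i" "x \<in> submodule_span R M (insert t T)" for x i
  proof -
    obtain r y where r: "r \<in> carrier R" "y \<in> submodule_span R M T" "x = r \<odot>\<^bsub>M\<^esub> t \<oplus>\<^bsub>M\<^esub> y"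
      using submodule_span_insertE[OF t T x(2)] .
    then have "r \<in> I k" using I_I[of r y i] x(1) k2 k by blast
    then obtain y' where y': "y' \<in> submodule_span R M T" "r \<odot>\<^bsub>M\<^esub> t \<oplus>\<^bsub>M\<^esub> y' \<in> N k"
      unfolding I_def by blast
    define j where "j = max i k"
    have "x \<in> N j" "r \<odot>\<^bsub>M\<^esub> t \<oplus>\<^bsub>M\<^esub> y' \<in> N j"
      using mono x(1) y'(2) unfolding j_def mono_def by (meson max.cobounded1 max.cobounded2 subsetD)+
    moreover have x_eq: "x = (r \<odot>\<^bsub>M\<^esub> t \<oplus>\<^bsub>M\<^esub> y') \<oplus>\<^bsub>M\<^esub> (y \<ominus>\<^bsub>M\<^esub> y')"
      using r y'(1) t Sc
      by (simp add: M.minus_eq M.a_assoc M.a_comm[of y "\<ominus>\<^bsub>M\<^esub> y'"] M.r_neg2)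
    ultimately have "x \<ominus>\<^bsub>M\<^esub> (r \<odot>\<^bsub>M\<^esub> t \<oplus>\<^bsub>M\<^esub> y') \<in> N j" by (intro submodule_diff[OF sub])
    also have "x \<ominus>\<^bsub>M\<^esub> (r \<odot>\<^bsub>M\<^esub> t \<oplus>\<^bsub>M\<^esub> y') = y \<ominus>\<^bsub>M\<^esub> y'"
      by (rule diff_eqI[OF x_eq]) (use r y' t Sc in simp_all)
    finally have "y \<ominus>\<^bsub>M\<^esub> y' \<in> N k"
      using k1 k submodule_diff[OF S r(2) y'(1)] by blast
    then show ?thesis
      unfolding x_eq using y'(2) submoduleE(5)[OF sub] by blast
  qed
  then show ?case by blast
qed

end

context local_ring_module
begin

text \<open>Each block of \<open>e\<close> factors from \<open>\<mm>\<close> extracts one more factor \<open>a\<close>.\<close>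

lemma ideal_pow_smult_elt_pow:
  assumes a: "a \<in> carrier R"
    and e: "\<And>r x. r \<in> ideal_pow R \<mm> e \<Longrightarrow> x \<in> carrier M \<Longrightarrow> r \<odot>\<^bsub>M\<^esub> x \<in> elt_smult a M"
    and "r \<in> ideal_pow R \<mm> (e * j)" "x \<in> carrier M"
  shows "r \<odot>\<^bsub>M\<^esub> x \<in> elt_smult (a [^] j) M"
  using assms(3,4)
proof (induct j arbitrary: r x)
  case 0
  then show ?case by (auto simp: elt_smult_def intro!: exI[of _ "r \<odot>\<^bsub>M\<^esub> x"])
next
  case (Suc j)
  note Pc = ideal.Icarr[OF ideal_pow_ideal[OF max.is_ideal]]
  have aj: "a [^] j \<in> carrier R" "a [^] Suc j \<in> carrier R" using a by simp_all
  have "r \<in> ideal_pow R \<mm> e \<cdot> ideal_pow R \<mm> (e * j)"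
    using Suc(2) by (simp add: ideal_pow_add[OF max.is_ideal])
  then have "r \<in> carrier R \<and> r \<odot>\<^bsub>M\<^esub> x \<in> elt_smult (a [^] Suc j) M"
  proof (induct r rule: ideal_prod.induct)
    case (prod p q)
    note pc = Pc[OF prod(1)] and qc = Pc[OF prod(2)]
    obtain z where z: "z \<in> carrier M" "q \<odot>\<^bsub>M\<^esub> x = (a [^] j) \<odot>\<^bsub>M\<^esub> z"
      using Suc(1)[OF prod(2) Suc(3)] unfolding elt_smult_def by blast
    obtain w where w: "w \<in> carrier M" "p \<odot>\<^bsub>M\<^esub> z = a \<odot>\<^bsub>M\<^esub> w"
      using e[OF prod(1) z(1)] unfolding elt_smult_def by blast
    have "(p \<otimes> q) \<odot>\<^bsub>M\<^esub> x = p \<odot>\<^bsub>M\<^esub> ((a [^] j) \<odot>\<^bsub>M\<^esub> z)"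
      using pc qc Suc(3) z(2) by (simp add: smult_assoc1)
    also have "\<dots> = (a [^] j) \<odot>\<^bsub>M\<^esub> (p \<odot>\<^bsub>M\<^esub> z)"
      using pc aj z(1) by (simp add: m_comm flip: smult_assoc1)
    also have "\<dots> = (a [^] Suc j) \<odot>\<^bsub>M\<^esub> w"
      using a aj w by (simp add: smult_assoc1)
    finally show ?case using w(1) pc qc unfolding elt_smult_def by blast
  next
    case (sum u v)
    then show ?case
      using submoduleE(5)[OF elt_smult_submodule[OF module_axioms aj(2)]] Suc(3)
      by (simp add: smult_l_distr)
  qed
  then show ?case by blast
qed

text \<open>Take \<open>k\<close> with \<open>(0 : a\<^sup>i) \<subseteq> (0 : a\<^sup>k)\<close> for all \<open>i\<close>, and \<open>e\<close> with
  \<open>\<mm>\<^sup>e M \<subseteq> aM\<close>. For \<open>a x = 0\<close> and \<open>r\<close> in \<open>\<mm>\<close> to the power \<open>e k\<close>, the element \<open>r x = a\<^sup>k z\<close>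
  is killed by \<open>a\<close>. So \<open>z\<close> is killed by the next power of \<open>a\<close>, hence by \<open>a\<^sup>k\<close>, and \<open>r x = 0\<close>.\<close>

lemma parameter_torsion:
  assumes noeth: "noetherian_ring R" and fg: "finitely_generated R M" and a: "parameter R \<mm> M a"
  shows "elt_torsion a M \<subseteq> torsion_submodule R \<mm> M"
proof
  fix x assume "x \<in> elt_torsion a M"
  then have x: "x \<in> carrier M" "a \<odot>\<^bsub>M\<^esub> x = \<zero>\<^bsub>M\<^esub>" unfolding elt_torsion_def by simp_all
  have ac: "a \<in> carrier R" and fl: "finite_length R (quotient_module M (elt_smult a M))"
    using a max.Icarr unfolding parameter_def by auto
  obtain e where e: "\<And>r x. r \<in> ideal_pow R \<mm> e \<Longrightarrow> x \<in> carrier M \<Longrightarrow> r \<odot>\<^bsub>M\<^esub> x \<in> elt_smult a M"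
    using finite_length_quotient_imp_ideal_pow_smult[OF elt_smult_submodule[OF module_axioms ac] fl]
    by blast
  obtain S where S: "finite S" "S \<subseteq> carrier M" "submodule_span R M S = carrier M"
    using fg unfolding finitely_generated_def by blast
  have Suc_pow: "(a [^] Suc i) \<odot>\<^bsub>M\<^esub> y = a \<odot>\<^bsub>M\<^esub> ((a [^] i) \<odot>\<^bsub>M\<^esub> y)"
    if "y \<in> carrier M" for i y
    using ac that m_comm[of a "a [^] i"] by (simp flip: smult_assoc1)
  have "elt_torsion (a [^] i) M \<subseteq> elt_torsion (a [^] Suc i) M" for i
    using ac Suc_pow[of _ i] unfolding elt_torsion_def by (auto simp del: nat_pow_Suc)
  then have "mono (\<lambda>i::nat. elt_torsion (a [^] i) M)"
    unfolding mono_iff_le_Suc by blast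
  from submodule_chain_stabilises[OF noeth S(1,2) elt_torsion_submodule this]
  obtain k :: nat where
    k: "\<And>i::nat. elt_torsion (a [^] i) M \<inter> carrier M \<subseteq> elt_torsion (a [^] k) M"
    unfolding S(3) using ac by blast
  have "r \<odot>\<^bsub>M\<^esub> x = \<zero>\<^bsub>M\<^esub>" if r: "r \<in> ideal_pow R \<mm> (e * k)" for r
  proof -
    have rc: "r \<in> carrier R" using ideal.Icarr[OF ideal_pow_ideal[OF max.is_ideal] r] .
    obtain z where z: "z \<in> carrier M" "r \<odot>\<^bsub>M\<^esub> x = (a [^] k) \<odot>\<^bsub>M\<^esub> z"
      using ideal_pow_smult_elt_pow[OF ac e r x(1)] unfolding elt_smult_def by blast
    have "(a [^] Suc k) \<odot>\<^bsub>M\<^esub> z = a \<odot>\<^bsub>M\<^esub> (r \<odot>\<^bsub>M\<^esub> x)" using z Suc_pow by simp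
    also have "\<dots> = r \<odot>\<^bsub>M\<^esub> (a \<odot>\<^bsub>M\<^esub> x)" using rc ac x(1) m_comm[of a r] by (simp flip: smult_assoc1)
    also have "\<dots> = \<zero>\<^bsub>M\<^esub>" using x rc by simp
    finally have "z \<in> elt_torsion (a [^] k) M"
      using k[of "Suc k"] z(1) unfolding elt_torsion_def by blast
    then show ?thesis using z(2) unfolding elt_torsion_def by simp
  qed
  \<comment> \<open>The exponent in the definition of torsion has to be positive, while \<open>e * k\<close> may be \<open>0\<close>.\<close>
  then have "\<forall>r\<in>ideal_pow R \<mm> (Suc (e * k)). r \<odot>\<^bsub>M\<^esub> x = \<zero>\<^bsub>M\<^esub>"
    using ideal_pow_Suc_subset[OF max.is_ideal] by blast
  then show "x \<in> torsion_submodule R \<mm> M"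
    using x(1) unfolding torsion_submodule_def by (auto intro!: exI[of _ "Suc (e * k)"])
qed

lemma annihilator_ideal: "ideal (annihilator R M) R"
  by (rule R.ideal_criterion) (auto simp: annihilator_def smult_l_distr smult_assoc1)

text \<open>A prime of \<open>R / Ann(M)\<close> contains the image of \<open>\<mm>\<close>, since the \<open>k\<close>-th powers of elements of \<open>\<mm>\<close>
  vanish there, and nothing else, since all other elements come from units. So there is at most one
  prime ideal, and the dimension is zero.\<close>

lemma primeideal_quotient_annihilator:
  assumes k: "\<And>r x. r \<in> ideal_pow R \<mm> k \<Longrightarrow> x \<in> carrier M \<Longrightarrow> r \<odot>\<^bsub>M\<^esub> x = \<zero>\<^bsub>M\<^esub>"
    and P: "primeideal P (R Quot annihilator R M)"
  shows "P = (\<lambda>r. annihilator R M +> r) ` \<mm>"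
proof -
  let ?A = "annihilator R M" and ?Q = "R Quot annihilator R M"
  have zero: "\<zero>\<^bsub>?Q\<^esub> = ?A" and one: "\<one>\<^bsub>?Q\<^esub> = ?A +> \<one>"
    and carrier: "carrier ?Q = (\<lambda>r. ?A +> r) ` carrier R"
    by (auto simp: FactRing_def A_RCOSETS_def')
  interpret A: ideal ?A R by (rule annihilator_ideal)
  interpret P: primeideal P ?Q by (rule P)
  interpret h: ring_hom_ring R ?Q "\<lambda>r. ?A +> r" by (rule A.rcos_ring_hom_ring)
  have "?A +> r \<in> P" if r: "r \<in> \<mm>" for r
  proof -
    have rc: "r \<in> carrier R" using r by (rule max.Icarr)
    have "r [^] k \<in> ?A"
      using k[OF nat_pow_in_ideal_pow[OF r]] rc unfolding annihilator_def by simp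
    then have "?A +> r [^] k = ?A" by (rule A.a_rcos_const)
    then have "?A +> r [^] k \<in> P" using additive_subgroup.zero_closed[OF ideal.axioms(1)[OF P.is_ideal]] unfolding zero by (simp only:)
    then show ?thesis
    proof (induct k)
      case 0
      then have "\<one>\<^bsub>?Q\<^esub> \<in> P" unfolding one by (simp only: R.nat_pow_0)
      then show ?case using P.I_notcarr P.one_imp_carrier by blast
    next
      case (Suc k)
      have "(?A +> r [^] k) \<otimes>\<^bsub>?Q\<^esub> (?A +> r) \<in> P"
        using Suc.prems h.hom_mult[OF R.nat_pow_closed[OF rc, of k] rc] unfolding R.nat_pow_Suc by (simp only:)
      then show ?case
        using P.I_prime[OF h.hom_closed h.hom_closed, of "r [^] k" r] rc Suc.hyps by blast
    qed
  qed
  moreover have "X \<in> (\<lambda>r. ?A +> r) ` \<mm>" if X: "X \<in> P" for X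
  proof -
    obtain r where r: "r \<in> carrier R" "X = ?A +> r"
      using P.Icarr[OF X] unfolding carrier by blast
    have "r \<in> \<mm>"
    proof (rule ccontr)
      assume "r \<notin> \<mm>"
      then have u: "r \<in> Units R" using nonunit_in_maximal_ideal r(1) by blast
      have "(?A +> inv r) \<otimes>\<^bsub>?Q\<^esub> X \<in> P"
        by (rule P.I_l_closed[OF X h.hom_closed[OF Units_inv_closed[OF u]]])
      also have "(?A +> inv r) \<otimes>\<^bsub>?Q\<^esub> X = ?A +> (inv r \<otimes> r)"
        unfolding r(2) using h.hom_mult[OF Units_inv_closed[OF u] r(1)] by (simp only:)
      also have "\<dots> = \<one>\<^bsub>?Q\<^esub>" unfolding one Units_l_inv[OF u] ..
      finally show False using P.I_notcarr P.one_imp_carrier by blast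
    qed
    then show ?thesis using r(2) by blast
  qed
  ultimately show ?thesis by blast
qed

lemma annihilated_imp_dim_zero:
  assumes "\<And>r x. r \<in> ideal_pow R \<mm> k \<Longrightarrow> x \<in> carrier M \<Longrightarrow> r \<odot>\<^bsub>M\<^esub> x = \<zero>\<^bsub>M\<^esub>"
  shows "module_dim R M = 0"
proof -
  have "length Cs - 1 = 0"
    if Cs: "sorted_wrt (\<subset>) Cs" "set Cs \<subseteq> {P. primeideal P (R Quot annihilator R M)}" for Cs
  proof (rule ccontr)
    assume "length Cs - 1 \<noteq> 0"
    then have "1 < length Cs" by simp
    then have lt: "Cs ! 0 \<subset> Cs ! 1" and mem: "Cs ! 0 \<in> set Cs" "Cs ! 1 \<in> set Cs"
      using sorted_wrt_nth_less[OF Cs(1), of 0 1] nth_mem[of 0 Cs] nth_mem[of 1 Cs] by linarith+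
    have "P = (\<lambda>r. annihilator R M +> r) ` \<mm>" if "P \<in> set Cs" for P
      by (rule primeideal_quotient_annihilator[OF assms]) (use that Cs(2) in auto)
    from this[OF mem(1)] this[OF mem(2)] lt show False by simp
  qed
  then show ?thesis
    unfolding module_dim_def krull_dim_def chain_height_def
    by (auto simp: zero_enat_def[symmetric] bot_enat_def intro!: antisym SUP_least)
qed

text \<open>If multiplication by \<open>a\<close> were injective, then \<open>[a]\<close> would be a regular sequence, as \<open>aM \<noteq> M\<close> by
  Nakayama's lemma, and the depth would be at least one.\<close>

lemma depth_zero_imp_elt_torsion_nonzero:
  assumes fg: "finitely_generated R M" and nz: "carrier M \<noteq> {\<zero>\<^bsub>M\<^esub>}"
    and depth: "module_depth R \<mm> M = 0" and a: "a \<in> \<mm>"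
  shows "elt_torsion a M \<noteq> {\<zero>\<^bsub>M\<^esub>}"
proof
  assume *: "elt_torsion a M = {\<zero>\<^bsub>M\<^esub>}"
  have ac: "a \<in> carrier R" using a by (rule max.Icarr)
  note aM = elt_smult_submodule[OF module_axioms ac]
  have Idl_empty: "Idl {} = {\<zero>}"
    using genideal_minimal[OF zeroideal, of "{}"]
      additive_subgroup.zero_closed[OF ideal.axioms(1)[OF genideal_ideal[of "{}"]]] by auto
  have zeroM: "ideal_smult R (Idl {}) M = {\<zero>\<^bsub>M\<^esub>}"
  proof -
    let ?S = "{r \<odot>\<^bsub>M\<^esub> x | r x. r \<in> {\<zero>} \<and> x \<in> carrier M}"
    have eq: "ideal_smult R (Idl {}) M = submodule_span R M ?S" by (simp add: ideal_smult_def Idl_empty)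
    have S: "?S \<subseteq> {\<zero>\<^bsub>M\<^esub>}" by auto
    then have "?S \<subseteq> carrier M" by blast
    from submodule_zero[OF span_submodule[OF this]] submodule_span_minimal[OF zero_submodule S]
    show ?thesis unfolding eq by blast
  qed
  have "nonzerodivisor_on a (quotient_module M {\<zero>\<^bsub>M\<^esub>})"
    using * ac unfolding nonzerodivisor_on_def elt_torsion_def
    by (auto simp: carrier_quotient zero_quotient smult_quotient[OF zero_submodule]
        coset_eq_zero_iff[OF zero_submodule])
  moreover have "ideal_smult R (Idl {a}) M \<noteq> carrier M"
  proof
    assume eq: "ideal_smult R (Idl {a}) M = carrier M"
    have "ideal_smult R (Idl {a}) M \<subseteq> elt_smult a M"
      unfolding ideal_smult_def
    proof (rule submodule_span_minimal[OF aM], clarify)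
      fix r x assume r: "r \<in> Idl {a}" and x: "x \<in> carrier M"
      have "r \<in> PIdl a" using r cgenideal_eq_genideal[OF ac] by simp
      then obtain s where "s \<in> carrier R" "r = a \<otimes> s"
        using ac m_comm unfolding cgenideal_def by blast
      then show "r \<odot>\<^bsub>M\<^esub> x \<in> elt_smult a M"
        using ac x by (auto simp: elt_smult_def smult_assoc1)
    qed
    then have "elt_smult \<one> M \<subseteq> elt_smult (\<one> \<otimes> a) M" using eq ac by (auto simp: elt_smult_def)
    then have "elt_smult \<one> M = {\<zero>\<^bsub>M\<^esub>}" using nakayama_elt_smult[OF fg one_closed a] by blast
    moreover have "elt_smult \<one> M = carrier M" by (force simp: elt_smult_def)
    ultimately show False using nz by simp
  qed
  ultimately have "regular_sequence R M [a]"
    unfolding regular_sequence_def using ac zeroM by simp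
  then have "enat (length [a]) \<le> module_depth R \<mm> M"
    unfolding module_depth_def by (intro SUP_upper) (use a in simp)
  then show False using depth by (simp add: zero_enat_def)
qed

end

section \<open>Homomorphisms from a cyclic module\<close>

context module
begin

text \<open>The ideal \<open>(a)\<close> is the submodule \<open>a R\<close> of the module \<open>R\<close>, and cosets of it are the same sets whether
  taken in the ring or in the module. This makes the results on quotient modules available for
  \<open>R/(a)\<close>.\<close>

lemma principal_ideal_submodule:
  assumes a: "a \<in> carrier R"
  shows "submodule (PIdl a) R (ring_as_module R)"
    and "(PIdl a) +>\<^bsub>ring_as_module R\<^esub> r = PIdl a +> r"
proof -
  have "PIdl a = elt_smult a (ring_as_module R)"
    using a m_comm by (auto simp: cgenideal_def elt_smult_def ring_as_module_def)
  then show "submodule (PIdl a) R (ring_as_module R)"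
    using elt_smult_submodule[OF ring_as_module_module[OF is_cring] a] by simp
  show "(PIdl a) +>\<^bsub>ring_as_module R\<^esub> r = PIdl a +> r"
    by (simp add: a_r_coset_def' ring_as_module_def)
qed


abbreviation hom_cyclic :: "'a \<Rightarrow> ('a, 'a set \<Rightarrow> 'c) module" where
  "hom_cyclic a \<equiv> hom_module R (quotient_module (ring_as_module R) (PIdl a)) M"

text \<open>The coset of \<open>r\<close> is \<open>r\<close> times the coset of \<open>1\<close>; so linearity determines \<open>f\<close> from its value there, and
  that value is killed by \<open>a\<close> because the coset of \<open>a\<close> is zero.\<close>

lemma hom_cyclic_eval:
  assumes a: "a \<in> carrier R" and f: "f \<in> carrier (hom_cyclic a)" and r: "r \<in> carrier R"
  shows "f (PIdl a +> r) = r \<odot>\<^bsub>M\<^esub> f (PIdl a +> \<one>)"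
    and "f (PIdl a +> r) \<in> carrier M"
    and "f (PIdl a +> \<one>) \<in> elt_torsion a M"
proof -
  interpret W: module R "ring_as_module R" by (rule ring_as_module_module[OF is_cring])
  note I = principal_ideal_submodule[OF a]
  have W: "carrier (ring_as_module R) = carrier R" "\<And>x y. x \<odot>\<^bsub>ring_as_module R\<^esub> y = x \<otimes> y"
    by (simp_all add: ring_as_module_def)
  have car: "PIdl a +> s \<in> carrier (quotient_module (ring_as_module R) (PIdl a))"
    if "s \<in> carrier R" for s
    using that by (simp add: W.carrier_quotient W I(2))
  have smult: "s \<odot>\<^bsub>quotient_module (ring_as_module R) (PIdl a)\<^esub> (PIdl a +> \<one>) = PIdl a +> s"
    if "s \<in> carrier R" for s
    using W.smult_quotient[OF I(1) that, of \<one>] that by (simp add: W I(2))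
  have lin: "f (s \<odot>\<^bsub>quotient_module (ring_as_module R) (PIdl a)\<^esub> C) = s \<odot>\<^bsub>M\<^esub> f C"
    and fc: "f C \<in> carrier M"
    if "s \<in> carrier R" "C \<in> carrier (quotient_module (ring_as_module R) (PIdl a))" for s C
    using f that unfolding hom_module_def by auto
  have eval: "f (PIdl a +> s) = s \<odot>\<^bsub>M\<^esub> f (PIdl a +> \<one>)" if "s \<in> carrier R" for s
    using lin[OF that car[OF one_closed]] smult[OF that] by simp
  show "f (PIdl a +> r) = r \<odot>\<^bsub>M\<^esub> f (PIdl a +> \<one>)" by (rule eval[OF r])
  show "f (PIdl a +> r) \<in> carrier M" by (rule fc[OF r car[OF r]])
  have f1: "f (PIdl a +> \<one>) \<in> carrier M" using fc[OF r car] by simp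
  interpret I: ideal "PIdl a" R by (rule cgenideal_ideal[OF a])
  have "PIdl a +> a = PIdl a +> \<zero>"
    using I.a_rcos_const[OF cgenideal_self[OF a]] I.a_rcos_const[OF I.zero_closed] by simp
  then have "a \<odot>\<^bsub>M\<^esub> f (PIdl a +> \<one>) = \<zero>\<^bsub>M\<^esub>"
    using eval[OF a] eval[OF R.zero_closed] f1 by simp
  then show "f (PIdl a +> \<one>) \<in> elt_torsion a M" using f1 unfolding elt_torsion_def by simp
qed

lemma hom_cyclic_eqI:
  assumes a: "a \<in> carrier R" and f: "f \<in> carrier (hom_cyclic a)" and g: "g \<in> carrier (hom_cyclic a)"
    and "f (PIdl a +> \<one>) = g (PIdl a +> \<one>)"
  shows "f = g"
proof (rule extensionalityI)
  interpret W: module R "ring_as_module R" by (rule ring_as_module_module[OF is_cring])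
  show "f \<in> extensional (carrier (quotient_module (ring_as_module R) (PIdl a)))"
    "g \<in> extensional (carrier (quotient_module (ring_as_module R) (PIdl a)))"
    using f g unfolding hom_module_def by (auto simp: PiE_def)
  fix C assume "C \<in> carrier (quotient_module (ring_as_module R) (PIdl a))"
  then obtain r where r: "r \<in> carrier R" "C = PIdl a +> r"
    unfolding W.carrier_quotient principal_ideal_submodule(2)[OF a] by (auto simp: ring_as_module_def)
  show "f C = g C"
    unfolding r(2) hom_cyclic_eval(1)[OF a f r(1)] hom_cyclic_eval(1)[OF a g r(1)] assms(4) ..
qed

text \<open>The homomorphism is the coset of \<open>r\<close> mapped to \<open>r p\<close>, which does not depend on the representative
  because \<open>a p = 0\<close>.\<close>

lemma hom_cyclic_exists:
  assumes a: "a \<in> carrier R" and p: "p \<in> elt_torsion a M"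
  obtains f where "f \<in> carrier (hom_cyclic a)" "f (PIdl a +> \<one>) = p"
proof -
  interpret W: module R "ring_as_module R" by (rule ring_as_module_module[OF is_cring])
  let ?Q = "quotient_module (ring_as_module R) (PIdl a)"
  note I = principal_ideal_submodule[OF a]
  have pc: "p \<in> carrier M" and ap: "a \<odot>\<^bsub>M\<^esub> p = \<zero>\<^bsub>M\<^esub>" using p unfolding elt_torsion_def by simp_all
  have W: "carrier (ring_as_module R) = carrier R" "\<And>x y. x \<odot>\<^bsub>ring_as_module R\<^esub> y = x \<otimes> y"
    "\<And>x y. x \<oplus>\<^bsub>ring_as_module R\<^esub> y = x \<oplus> y"
    by (simp_all add: ring_as_module_def)
  have car: "carrier ?Q = (\<lambda>r. PIdl a +> r) ` carrier R" by (simp add: W.carrier_quotient W I(2))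
  define f where "f = (\<lambda>C\<in>carrier ?Q. (SOME r. r \<in> carrier R \<and> C = PIdl a +> r) \<odot>\<^bsub>M\<^esub> p)"
  have f: "f (PIdl a +> r) = r \<odot>\<^bsub>M\<^esub> p" if r: "r \<in> carrier R" for r
  proof -
    define s where "s = (SOME s. s \<in> carrier R \<and> PIdl a +> r = PIdl a +> s)"
    have s: "s \<in> carrier R \<and> PIdl a +> r = PIdl a +> s"
      unfolding s_def by (rule someI[of _ r]) (use r in simp)
    interpret I: ideal "PIdl a" R by (rule cgenideal_ideal[OF a])
    have "s \<in> PIdl a +> r" using s I.a_rcos_self[of s] by simp
    then obtain q where "q \<in> carrier R" "s = q \<otimes> a \<oplus> r"
      unfolding a_r_coset_def' cgenideal_def by blast
    then have "s \<odot>\<^bsub>M\<^esub> p = r \<odot>\<^bsub>M\<^esub> p"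
      using r a pc ap by (simp add: smult_l_distr smult_assoc1)
    moreover have "f (PIdl a +> r) = s \<odot>\<^bsub>M\<^esub> p" unfolding f_def s_def using r by (simp add: car)
    ultimately show ?thesis by simp
  qed
  have add: "(PIdl a +> r) \<oplus>\<^bsub>?Q\<^esub> (PIdl a +> s) = PIdl a +> (r \<oplus> s)"
    and smult: "r \<odot>\<^bsub>?Q\<^esub> (PIdl a +> s) = PIdl a +> (r \<otimes> s)"
    if "r \<in> carrier R" "s \<in> carrier R" for r s
    using W.add_quotient[OF I(1), of r s] W.smult_quotient[OF I(1), of r s] that
    by (simp_all add: W I(2))
  have "f \<in> carrier ?Q \<rightarrow>\<^sub>E carrier M"
    using f pc by (auto simp: PiE_def car) (simp add: f_def car)
  then have "f \<in> carrier (hom_cyclic a)"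
    unfolding hom_module_def using pc by (auto simp: car f add smult smult_l_distr smult_assoc1)
  moreover have "f (PIdl a +> \<one>) = p" using f[OF one_closed] pc by simp
  ultimately show thesis using that by blast
qed

text \<open>Evaluation at the coset of \<open>1\<close> is an isomorphism onto \<open>(0 : a)\<close>, so the decomposition of the latter
  pulls back.\<close>

lemma hom_cyclic_decomposable:
  assumes a: "a \<in> carrier R"
    and X: "submodule X R M" "X \<noteq> {\<zero>\<^bsub>M\<^esub>}" and Y: "submodule Y R M" "Y \<noteq> {\<zero>\<^bsub>M\<^esub>}"
    and int: "X \<inter> Y = {\<zero>\<^bsub>M\<^esub>}" and sum: "X <+>\<^bsub>M\<^esub> Y = elt_torsion a M"
  shows "decomposable R (hom_cyclic a)"
proof -
  let ?Q = "quotient_module (ring_as_module R) (PIdl a)"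
  interpret W: module R "ring_as_module R" by (rule ring_as_module_module[OF is_cring])
  note I = principal_ideal_submodule[OF a]
  have u: "PIdl a +> \<one> \<in> carrier ?Q"
    unfolding W.carrier_quotient I(2) by (simp add: ring_as_module_def)
  define ev where "ev f = f (PIdl a +> \<one>)" for f :: "'a set \<Rightarrow> 'c"
  have ev_add: "ev (f \<oplus>\<^bsub>hom_cyclic a\<^esub> g) = ev f \<oplus>\<^bsub>M\<^esub> ev g"
    and ev_smult: "ev (r \<odot>\<^bsub>hom_cyclic a\<^esub> f) = r \<odot>\<^bsub>M\<^esub> ev f"
    and ev_zero: "ev \<zero>\<^bsub>hom_cyclic a\<^esub> = \<zero>\<^bsub>M\<^esub>" for f g r
    using u by (simp_all add: ev_def hom_module_def)
  interpret H: module R "hom_cyclic a"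
    by (rule hom_module_module[OF quotient_module_module[OF W.module_axioms I(1)] module_axioms])
  have evc: "ev f \<in> carrier M" "ev f \<in> elt_torsion a M" if "f \<in> carrier (hom_cyclic a)" for f
    unfolding ev_def using hom_cyclic_eval(2,3)[OF a that R.one_closed] by blast+
  have ev_inj: "f = g" if "f \<in> carrier (hom_cyclic a)" "g \<in> carrier (hom_cyclic a)" "ev f = ev g" for f g
    using hom_cyclic_eqI[OF a] that unfolding ev_def by blast
  have ev_surj: "\<exists>f\<in>carrier (hom_cyclic a). ev f = p" if "p \<in> elt_torsion a M" for p
    using hom_cyclic_exists[OF a that] unfolding ev_def by blast
  have ev_minus: "ev (\<ominus>\<^bsub>hom_cyclic a\<^esub> f) = \<ominus>\<^bsub>M\<^esub> ev f" if f: "f \<in> carrier (hom_cyclic a)" for f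
  proof -
    have "ev (\<ominus>\<^bsub>hom_cyclic a\<^esub> f) \<oplus>\<^bsub>M\<^esub> ev f = \<zero>\<^bsub>M\<^esub>"
      using ev_add[of "\<ominus>\<^bsub>hom_cyclic a\<^esub> f" f] f ev_zero by (simp add: H.M.l_neg)
    then show ?thesis using M.minus_equality evc f H.M.a_inv_closed by metis
  qed
  define pre where "pre Z = {f \<in> carrier (hom_cyclic a). ev f \<in> Z}" for Z
  have pre_sub: "submodule (pre Z) R (hom_cyclic a)" if Z: "submodule Z R M" for Z
    by (rule H.submoduleI)
      (use submodule_zero[OF Z] submoduleE(3,4,5)[OF Z] in
        \<open>auto simp: pre_def ev_add ev_smult ev_zero ev_minus\<close>)
  have zero_pre: "pre {\<zero>\<^bsub>M\<^esub>} = {\<zero>\<^bsub>hom_cyclic a\<^esub>}"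
    unfolding pre_def using ev_inj ev_zero by fastforce
  have XY: "X \<subseteq> elt_torsion a M" "Y \<subseteq> elt_torsion a M"
  proof -
    have add_mem: "x \<oplus>\<^bsub>M\<^esub> y \<in> elt_torsion a M" if "x \<in> X" "y \<in> Y" for x y
      using that unfolding sum[symmetric] set_add_def' by blast
    have "x \<in> elt_torsion a M" if "x \<in> X" for x
      using add_mem[OF that submodule_zero[OF Y(1)]] submodule_carrier[OF X(1) that] by simp
    moreover have "y \<in> elt_torsion a M" if "y \<in> Y" for y
      using add_mem[OF submodule_zero[OF X(1)] that] submodule_carrier[OF Y(1) that] by simp
    ultimately show "X \<subseteq> elt_torsion a M" "Y \<subseteq> elt_torsion a M" by blast+
  qed
  have nz: "pre Z \<noteq> {\<zero>\<^bsub>hom_cyclic a\<^esub>}"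
    if Z: "submodule Z R M" "Z \<noteq> {\<zero>\<^bsub>M\<^esub>}" "Z \<subseteq> elt_torsion a M" for Z
  proof -
    obtain z where z: "z \<in> Z" "z \<noteq> \<zero>\<^bsub>M\<^esub>" using Z submodule_zero[OF Z(1)] by blast
    then obtain f where "f \<in> carrier (hom_cyclic a)" "ev f = z" using ev_surj Z(3) by blast
    then have "f \<in> pre Z" "f \<noteq> \<zero>\<^bsub>hom_cyclic a\<^esub>" using z ev_zero unfolding pre_def by auto
    then show ?thesis by blast
  qed
  have "pre X \<inter> pre Y = {\<zero>\<^bsub>hom_cyclic a\<^esub>}"
    using zero_pre int unfolding pre_def by blast
  moreover have "pre X <+>\<^bsub>hom_cyclic a\<^esub> pre Y = carrier (hom_cyclic a)"
  proof
    show "pre X <+>\<^bsub>hom_cyclic a\<^esub> pre Y \<subseteq> carrier (hom_cyclic a)"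
      unfolding set_add_def' pre_def by auto
    show "carrier (hom_cyclic a) \<subseteq> pre X <+>\<^bsub>hom_cyclic a\<^esub> pre Y"
    proof
      fix f assume f: "f \<in> carrier (hom_cyclic a)"
      have "ev f \<in> X <+>\<^bsub>M\<^esub> Y" using evc(2)[OF f] sum by simp
      then obtain x y where xy: "x \<in> X" "y \<in> Y" "ev f = x \<oplus>\<^bsub>M\<^esub> y" unfolding set_add_def' by blast
      obtain g h where gh: "g \<in> carrier (hom_cyclic a)" "ev g = x"
        "h \<in> carrier (hom_cyclic a)" "ev h = y"
        using ev_surj XY xy(1,2) by blast
      then have "f = g \<oplus>\<^bsub>hom_cyclic a\<^esub> h"
        using f xy(3) by (intro ev_inj) (auto simp: ev_add)
      then show "f \<in> pre X <+>\<^bsub>hom_cyclic a\<^esub> pre Y"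
        using gh xy unfolding set_add_def' pre_def by blast
    qed
  qed
  ultimately show ?thesis
    unfolding decomposable_def
    using pre_sub[OF X(1)] pre_sub[OF Y(1)] nz[OF X XY(1)] nz[OF Y XY(2)] by blast
qed

end

section \<open>The decomposition\<close>

theorem theorem3p1:
  fixes R :: "('a, 'r) ring_scheme" and \<mm> :: "'a set"
    and M :: "('a, 'b, 'm) module_scheme" and n :: nat and a b :: 'a
  assumes "local_ring R \<mm>" and "noetherian_ring R"
    and "module R M" and "finitely_generated R M" and "carrier M \<noteq> {\<zero>\<^bsub>M\<^esub>}"
    and "module_dim R M = 1" and "module_depth R \<mm> M = 0"
    and "ideal_smult R (ideal_pow R \<mm> n) M \<inter> torsion_submodule R \<mm> M = {\<zero>\<^bsub>M\<^esub>}"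
    and "parameter R \<mm> M a"
    and "parameter R \<mm> M b" and "b \<in> PIdl\<^bsub>R\<^esub> (a [^]\<^bsub>R\<^esub> (n + 1))"
  shows "decomposable R
    (hom_module R (quotient_module (ring_as_module R) (PIdl\<^bsub>R\<^esub> a))
                  (quotient_module M (elt_smult b M)))"
proof -
  interpret local_ring_module R \<mm> M
    by (rule local_ring_module.intro[OF assms(3,1)])
  have am: "a \<in> \<mm>" and bm: "b \<in> \<mm>" using assms(9,10) unfolding parameter_def by simp_all
  have a: "a \<in> carrier R" and b: "b \<in> carrier R" using am bm max.Icarr by simp_all
  obtain c where c: "c \<in> carrier R" "b = c \<otimes>\<^bsub>R\<^esub> a [^]\<^bsub>R\<^esub> (n + 1)"
    using assms(11) unfolding cgenideal_def by blast
  \<comment> \<open>The factor \<open>a\<^sup>n\<close> of \<open>d\<close> puts \<open>dM\<close> inside \<open>\<mm>\<^sup>n M\<close>; the remaining factor \<open>a\<close> of \<open>b\<close> makes \<open>dM\<close>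
    part of \<open>(bM : a)\<close>.\<close>
  define d where "d = c \<otimes>\<^bsub>R\<^esub> a [^]\<^bsub>R\<^esub> n"
  have d: "d \<in> carrier R" using c(1) a unfolding d_def by simp
  have b_eq: "b = d \<otimes>\<^bsub>R\<^esub> a" using c a unfolding d_def by (simp add: R.m_assoc)
  define B where "B = elt_smult b M"
  define D where "D = elt_smult d M"
  define T where "T = elt_torsion a M"
  have B: "submodule B R M" and D: "submodule D R M" and T: "submodule T R M"
    unfolding B_def D_def T_def
    using elt_smult_submodule[OF module_axioms] elt_torsion_submodule a b d by auto
  note Bc = submodule_carrier[OF B] and Dc = submodule_carrier[OF D] and Tc = submodule_carrier[OF T]
  have "B \<subseteq> D"
  proof
    fix x assume "x \<in> B"
    then obtain z where "z \<in> carrier M" "x = d \<odot>\<^bsub>M\<^esub> (a \<odot>\<^bsub>M\<^esub> z)"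
      unfolding B_def elt_smult_def b_eq using smult_assoc1[OF d a] by auto
    then show "x \<in> D" using a unfolding D_def elt_smult_def by blast
  qed
  have DT: "D \<inter> T = {\<zero>\<^bsub>M\<^esub>}"
  proof -
    have "d \<in> ideal_pow R \<mm> n"
      unfolding d_def
      using ideal.I_l_closed[OF ideal_pow_ideal[OF max.is_ideal] nat_pow_in_ideal_pow[OF am] c(1)] .
    then have "D \<subseteq> ideal_smult R (ideal_pow R \<mm> n) M"
      unfolding D_def elt_smult_def ideal_smult_def
      using submodule_span_superset[of "{r \<odot>\<^bsub>M\<^esub> x | r x. r \<in> ideal_pow R \<mm> n \<and> x \<in> carrier M}"]
      by blast
    moreover have "T \<subseteq> torsion_submodule R \<mm> M"
      unfolding T_def by (rule parameter_torsion[OF assms(2,4,9)])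
    ultimately show ?thesis using assms(8) submodule_zero[OF D] submodule_zero[OF T] by blast
  qed
  have T_nz: "T \<noteq> {\<zero>\<^bsub>M\<^esub>}"
    unfolding T_def by (rule depth_zero_imp_elt_torsion_nonzero[OF assms(4,5,7) am])
  have D_B: "\<not> D \<subseteq> B"
  proof
    assume "D \<subseteq> B"
    then have "D = {\<zero>\<^bsub>M\<^esub>}"
      using nakayama_elt_smult[OF assms(4) d am] unfolding D_def B_def b_eq by blast
    then have "B = {\<zero>\<^bsub>M\<^esub>}" using \<open>B \<subseteq> D\<close> submodule_zero[OF B] by blast
    have fl: "finite_length R (quotient_module M B)"
      using assms(10) unfolding parameter_def B_def by blast
    obtain k where k: "\<And>r x. r \<in> ideal_pow R \<mm> k \<Longrightarrow> x \<in> carrier M \<Longrightarrow> r \<odot>\<^bsub>M\<^esub> x \<in> B"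
      using finite_length_quotient_imp_ideal_pow_smult[OF B fl] by blast
    have "module_dim R M = 0"
      by (rule annihilated_imp_dim_zero[of k]) (use k \<open>B = {\<zero>\<^bsub>M\<^esub>}\<close> in blast)
    then show False using assms(6) by simp
  qed
  let ?P = "quotient_module M B"
  let ?\<pi> = "\<lambda>x. B +>\<^bsub>M\<^esub> x"
  interpret P: module R ?P by (rule quotient_module_module[OF module_axioms B])
  have "?\<pi> ` D \<noteq> {\<zero>\<^bsub>?P\<^esub>}"
    using D_B coset_eq_zero_iff[OF B Dc] unfolding zero_quotient by blast
  moreover have "?\<pi> ` T \<noteq> {\<zero>\<^bsub>?P\<^esub>}"
  proof -
    have "\<not> T \<subseteq> B" using T_nz DT \<open>B \<subseteq> D\<close> submodule_zero[OF T] by blast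
    then show ?thesis using coset_eq_zero_iff[OF B Tc] unfolding zero_quotient by blast
  qed
  moreover have "?\<pi> ` D \<inter> ?\<pi> ` T = {\<zero>\<^bsub>?P\<^esub>}"
  proof -
    have "?\<pi> x = B" if x: "x \<in> D" and y: "y \<in> T" and eq: "?\<pi> x = ?\<pi> y" for x y
    proof -
      have "y \<ominus>\<^bsub>M\<^esub> x \<in> B" using eq coset_eq_iff[OF B Tc[OF y] Dc[OF x]] by simp
      then have "(y \<ominus>\<^bsub>M\<^esub> x) \<oplus>\<^bsub>M\<^esub> x \<in> D" using \<open>B \<subseteq> D\<close> x submoduleE(5)[OF D] by blast
      also have "(y \<ominus>\<^bsub>M\<^esub> x) \<oplus>\<^bsub>M\<^esub> x = y"
        using Tc[OF y] Dc[OF x] by (simp add: M.minus_eq M.a_assoc M.l_neg)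
      finally have "y = \<zero>\<^bsub>M\<^esub>" using y DT by blast
      then show ?thesis using eq coset_eq_zero_iff[OF B Tc[OF y]] submodule_zero[OF B] by simp
    qed
    moreover have "?\<pi> \<zero>\<^bsub>M\<^esub> = B" using coset_eq_zero_iff[OF B M.zero_closed] submodule_zero[OF B] by simp
    ultimately show ?thesis
      using submodule_zero[OF D] submodule_zero[OF T] unfolding zero_quotient by blast
  qed
  moreover have "?\<pi> ` D <+>\<^bsub>?P\<^esub> ?\<pi> ` T = elt_torsion a ?P"
  proof
    have mem: "?\<pi> x \<in> elt_torsion a ?P \<longleftrightarrow> a \<odot>\<^bsub>M\<^esub> x \<in> B" if "x \<in> carrier M" for x
      using that a coset_eq_zero_iff[OF B, of "a \<odot>\<^bsub>M\<^esub> x"] smult_quotient[OF B a that]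
      unfolding elt_torsion_def zero_quotient carrier_quotient by simp
    show "?\<pi> ` D <+>\<^bsub>?P\<^esub> ?\<pi> ` T \<subseteq> elt_torsion a ?P"
    proof -
      have "?\<pi> x \<oplus>\<^bsub>?P\<^esub> ?\<pi> y \<in> elt_torsion a ?P" if x: "x \<in> D" and y: "y \<in> T" for x y
      proof -
        obtain z where z: "z \<in> carrier M" "x = d \<odot>\<^bsub>M\<^esub> z" using x unfolding D_def elt_smult_def by blast
        have "a \<odot>\<^bsub>M\<^esub> (x \<oplus>\<^bsub>M\<^esub> y) = b \<odot>\<^bsub>M\<^esub> z"
          using z y a d Dc[OF x] Tc[OF y] R.m_comm[OF d a]
          unfolding b_eq T_def elt_torsion_def by (simp add: smult_r_distr smult_assoc1)
        then have "a \<odot>\<^bsub>M\<^esub> (x \<oplus>\<^bsub>M\<^esub> y) \<in> B" using z(1) unfolding B_def elt_smult_def by blast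
        then show ?thesis using mem add_quotient[OF B] Dc[OF x] Tc[OF y] by simp
      qed
      then show ?thesis unfolding set_add_def' by blast
    qed
    show "elt_torsion a ?P \<subseteq> ?\<pi> ` D <+>\<^bsub>?P\<^esub> ?\<pi> ` T"
    proof
      fix X assume X: "X \<in> elt_torsion a ?P"
      then obtain x where x: "x \<in> carrier M" "X = ?\<pi> x"
        unfolding elt_torsion_def carrier_quotient by blast
      then have "a \<odot>\<^bsub>M\<^esub> x \<in> B" using mem X by simp
      then obtain y where y: "y \<in> carrier M" "a \<odot>\<^bsub>M\<^esub> x = b \<odot>\<^bsub>M\<^esub> y"
        unfolding B_def elt_smult_def by blast
      \<comment> \<open>Both \<open>x\<close> and \<open>d y\<close> become \<open>b y\<close> when multiplied by \<open>a\<close>.\<close>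
      define u where "u = d \<odot>\<^bsub>M\<^esub> y"
      have u: "u \<in> D" "u \<in> carrier M" using y(1) d unfolding u_def D_def elt_smult_def by auto
      have "a \<odot>\<^bsub>M\<^esub> u = a \<odot>\<^bsub>M\<^esub> x"
        using y a d R.m_comm[OF d a] unfolding u_def b_eq by (simp add: smult_assoc1)
      then have "a \<odot>\<^bsub>M\<^esub> (x \<ominus>\<^bsub>M\<^esub> u) = \<zero>\<^bsub>M\<^esub>"
        using a x u by (simp add: M.minus_eq smult_r_distr smult_r_minus M.r_neg)
      then have v: "x \<ominus>\<^bsub>M\<^esub> u \<in> T" using x u unfolding T_def elt_torsion_def by simp
      have "u \<oplus>\<^bsub>M\<^esub> (x \<ominus>\<^bsub>M\<^esub> u) = x"
        using x(1) u(2) by (simp add: M.minus_eq M.a_comm[of x] M.r_neg2)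
      then have "X = ?\<pi> u \<oplus>\<^bsub>?P\<^esub> ?\<pi> (x \<ominus>\<^bsub>M\<^esub> u)"
        using add_quotient[OF B u(2) Tc[OF v]] x(2) by simp
      then show "X \<in> ?\<pi> ` D <+>\<^bsub>?P\<^esub> ?\<pi> ` T" using u(1) v unfolding set_add_def' by blast
    qed
  qed
  ultimately show ?thesis
    using P.hom_cyclic_decomposable[OF a coset_image_submodule[OF B D] _ coset_image_submodule[OF B T]]
    unfolding B_def by blast
qed

end
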